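(* Consider problem (P) under the standing assumptions of the context, and let $\{x^k\}$ and $\{\gamma_k\}$ be generated by the algorithm sESQM described in the context. Suppose that: (CQ) $0\notin \partial g(x)+\mathcal{N}_{\mathcal{C}}(x)$ for every $x\in\mathcal{C}$ with $g(x)\ge 0$; (Parameters) $\{\mu_k\}$ is positive and nonincreasing, $\lim_{k\to\infty}\mu_k=0$, and $S_K:=\sum_{k=\lceil K/2\rceil}^{K}\mu_k\to\infty$ as $K\to\infty$; moreover $\lim_{k\to\infty}\widehat\gamma_k=0$ and there is $M_{\widehat\gamma}>1$ with $0<\widehat\gamma_{k+1}<\widehat\gamma_k\le M_{\widehat\gamma}\widehat\gamma_{k+1}$ for all $k\in\mathbb{N}_0$; (Convexity) $f$ is convex, $P_2=0$, and $c$ is $(-\mathrm{hzn}\,h)$-convex; (Rate of $\mu_k$) there exist $\bar r\in(\frac12,1)$, $b_1>0$, $b_2>0$ and $k_1\in\mathbb{N}_0$ such that $b_1(1+k)^{-\bar r}\le\mu_k\le b_2(1+k)^{-\bar r}$ for all $k\ge k_1$. Let $\psi_*$ and $\Omega^*$ be the optimal value and the solution set of (P), and let $\bar\gamma$ be as defined in the context. Assume there exist $\kappa>0$, $\theta\in[0,1)$, $\varepsilon_0>0$ and $\varepsilon_1\in(0,1)$ such that $$\mathrm{dist}(x,\Omega^* )\le\kappa\left(\psi(x)+\bar\gamma^{-1}g^+(x)-\psi_*\right)^{1-\theta}$$ for all $x\in\mathbb{X}$ with $\mathrm{dist}(x,\Omega^* )\le\varepsilon_0$ and $\psi(x)+\bar\gamma^{-1}g^+(x)\le\psi_*+\varepsilon_1$.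 Then $\{x^k\}$ converges to some $\bar x\in\Omega^*$, and there exist $\widetilde\kappa>0$ and $\widetilde k\in\mathbb{N}_0$ such that $$\|x^k-\bar x\|\le\widetilde\kappa(1+k)^{-s}\quad\forall k\ge\widetilde k,$$ where $$s:=\begin{cases}\bar r-\frac12&\text{if }\theta\in[0,\frac12],\\ \min\left\{\bar r-\frac12,\ \frac{(1-\bar r)(1-\theta)}{2\theta-1}\right\}&\text{if }\theta\in(\frac12,1).\end{cases}$$
   Context: **Notation.** $\mathbb{N}_0=\{0,1,2,\dots\}$; $[s]_+=\max\{s,0\}$; $\phi^+=\max\{\phi,0\}$; $\delta_{\mathcal{C}}$ is the indicator function (0 on $\mathcal{C}$, $+\infty$ off it); $\mathcal{N}_{\mathcal{C}}=\partial\delta_{\mathcal{C}}$ is the normal cone; $\partial$ is the limiting subdifferential (the usual one for convex functions); in the present setting $\partial g(x)=Dc(x)^*\partial h(c(x))$. "$L$-smooth on $\mathcal{C}$" means the derivative is $L$-Lipschitz on $\mathcal{C}$. $Dc(x)^*$ is the adjoint of the derivative. $\mathrm{hzn}\,h:=\{d\in\mathbb{Y}:h(y+d)\le h(y)\ \forall y\in\mathbb{Y}\}$; for a convex cone $\mathcal{K}$, $c$ is $\mathcal{K}$-convex if $tc(x)+(1-t)c(z)-c(tx+(1-t)z)\in\mathcal{K}$ for all $x,z\in\mathbb{X}$, $t\in[0,1]$. **Problem (P).** $\mathbb{X},\mathbb{Y}$ are finite-dimensional real Hilbert spaces: $$\min_{x\in\mathbb{X}}\ \psi(x):=f(x)+P_1(x)-P_2(x)+\delta_{\mathcal{C}}(x)\quad\text{s.t.}\quad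 g(x):=h(c(x))\le 0.$$ Standing assumptions: (i) $\mathcal{C}\subseteq\mathbb{X}$ is compact and convex and $\mathcal{F}:=\{x\in\mathcal{C}:g(x)\le0\}\ne\emptyset$; (ii) $f:\mathbb{X}\to\mathbb{R}$ and $c:\mathbb{X}\to\mathbb{Y}$ are continuously differentiable, $L_f$-smooth and $L_c$-smooth on $\mathcal{C}$ respectively ($L_f>0$, $L_c\ge0$), and $c$ is $M_c$-Lipschitz on $\mathcal{C}$ with $M_c>0$; (iii) $P_1,P_2:\mathbb{X}\to\mathbb{R}$ are convex; (iv) $h:\mathbb{Y}\to\mathbb{R}$ is convex and $M_h$-Lipschitz with $M_h>0$. **Smoothing.** A family of convex $C^1$ functions $\{\phi_\mu\}_{\mu>0}$ is a smoothing approximation (SA) of a convex $\phi:\mathbb{Y}\to\mathbb{R}$ with parameters $(\alpha_1^\phi,\alpha_2^\phi,\alpha_{3,1}^\phi,\alpha_{3,2}^\phi)$, where $\alpha_1^\phi\ge0$, $\alpha_2^\phi>0$, $\alpha_{3,1}^\phi,\alpha_{3,2}^\phi\in\mathbb{R}$ and $\alpha_3^\phi:=\alpha_{3,1}^\phi+\alpha_{3,2}^\phi>0$, if for all $\mu>0$: $\nabla\phi_\mu$ is $(\alpha_1^\phi+\alpha_2^\phi/\mu)$-Lipschitz and $\phi-\alpha_{3,1}^\phi\mu\le\phi_\mu\le\phi+\alpha_{3,2}^\phi\mu$ pointwise. Fixed throughout: an SA $\{h_\mu\}$ of $h$ with parameters $(\alpha_1^h,\alpha_2^h,\alpha_{3,1}^h,\alpha_{3,2}^h)$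 and a constant $\alpha_4^h\ge0$ with $h_{\mu_1}(y)\le h_{\mu_0}(y)+\alpha_4^h(\mu_0-\mu_1)$ for all $\mu_0\ge\mu_1>0$, $y\in\mathbb{Y}$; and an SA $\{\varphi_\mu\}$ of $[\cdot]_+:\mathbb{R}\to\mathbb{R}$ with parameters $(\alpha_1^\varphi,\alpha_2^\varphi,\alpha_{3,1}^\varphi,\alpha_{3,2}^\varphi)$ and a constant $\alpha_4^\varphi\ge0$ with $\varphi_{\mu_1}(s)\le\varphi_{\mu_0}(s)+\alpha_4^\varphi(\mu_0-\mu_1)$ for all $\mu_0\ge\mu_1>0$, $s\in\mathbb{R}$. Set $H_\mu:=\varphi_\mu\circ h_\mu$ and $g_\mu:=H_\mu\circ c$. **Algorithm sESQM.** Inputs: $x^0\in\mathcal{C}$, $\mu_0>0$, $\overline L\ge\underline L>0$, $c_1>0$, $c_2>0$, a strictly decreasing positive sequence $\{\widehat\gamma_k\}$, and the SAs above. Set $t_0=0$. For $k=0,1,2,\dots$: Step 1: take $\xi^k\in\partial P_2(x^k)$, $L_{k,0}\in[\underline L,\overline L]$; set $\gamma_k=\widehat\gamma_{t_k}$, $\widetilde L=L_{k,0}$. Step 2: compute $\widetilde x=\arg\min_{x\in\mathbb{X}}\{\gamma_k(\langle\nabla f(x^k)-\xi^k,x\rangle+P_1(x))+\ell_k(x)+\frac{\widetilde L}{2\mu_k}\|x-x^k\|^2+\delta_{\mathcal{C}}(x)\}$ with $\ell_k(x):=g_{\mu_k}(x^k)+\langle\nabla g_{\mu_k}(x^k),x-x^k\rangle$.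 Step 3: if $\gamma_k\psi(\widetilde x)+g_{\mu_k}(\widetilde x)\le\gamma_k\psi(x^k)+g_{\mu_k}(x^k)-\frac{c_1}{2\mu_k}\|\widetilde x-x^k\|^2$ go to Step 4; otherwise replace $\widetilde L$ by $2\widetilde L$ and go to Step 2. Step 4: set $x^{k+1}=\widetilde x$, $L_k=\widetilde L$. If $h_{\mu_k}(c(x^{k+1}))>2\alpha_3^\varphi\mu_k$ and $\|x^{k+1}-x^k\|\le c_2\mu_k\gamma_k$, set $t_{k+1}=t_k+1$; otherwise $t_{k+1}=t_k$. Step 5: choose $\mu_{k+1}\in(0,\mu_k]$. **Definition of $\bar\gamma$.** $\bar k:=\min\{k\in\mathbb{N}_0:t_j=t_k\ \forall j\ge k\}-1$ (finite under the hypotheses), $\bar\gamma:=\gamma_{\bar k+1}$. *)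

theory Defs
  imports "HOL-Analysis.Analysis"
begin

definition indicator_ext :: "'a set \<Rightarrow> 'a \<Rightarrow> ereal" where
  "indicator_ext C x = (if x \<in> C then 0 else \<infinity>)"

definition frechet_subdiff :: "('a::real_inner \<Rightarrow> ereal) \<Rightarrow> 'a \<Rightarrow> 'a set" where
  "frechet_subdiff F x =
     {v. \<bar>F x\<bar> \<noteq> \<infinity> \<and>
         0 \<le> Liminf (at x) (\<lambda>y. (F y - F x - ereal (v \<bullet> (y - x))) / ereal (norm (y - x)))}"

definition limiting_subdiff :: "('a::real_inner \<Rightarrow> ereal) \<Rightarrow> 'a \<Rightarrow> 'a set" where
  "limiting_subdiff F x =
     {v. \<bar>F x\<bar> \<noteq> \<infinity> \<and>
         (\<exists>X V. X \<longlonglongrightarrow> x \<and> (\<lambda>n. F (X n)) \<longlonglongrightarrow> F x \<and>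
                (\<forall>n. V n \<in> frechet_subdiff F (X n)) \<and> V \<longlonglongrightarrow> v)}"

definition normal_cone :: "'a::real_inner set \<Rightarrow> 'a \<Rightarrow> 'a set" where
  "normal_cone C = limiting_subdiff (indicator_ext C)"

definition total_deriv ::
  "('a::real_normed_vector \<Rightarrow> 'b::real_normed_vector) \<Rightarrow> 'a \<Rightarrow> ('a \<Rightarrow>\<^sub>L 'b)" where
  "total_deriv f x = Blinfun (frechet_derivative f (at x))"

definition C1_fun :: "('a::real_normed_vector \<Rightarrow> 'b::real_normed_vector) \<Rightarrow> bool" where
  "C1_fun f \<longleftrightarrow> (\<forall>x. f differentiable (at x)) \<and> continuous_on UNIV (total_deriv f)"

definition smooth_on_set ::
  "real \<Rightarrow> 'a::real_normed_vector set \<Rightarrow> ('a \<Rightarrow> 'b::real_normed_vector) \<Rightarrow> bool" where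
  "smooth_on_set L C f \<longleftrightarrow> L-lipschitz_on C (total_deriv f)"

definition grad :: "('a::real_inner \<Rightarrow> real) \<Rightarrow> 'a \<Rightarrow> 'a" where
  "grad f x = (THE D. GDERIV f x :> D)"

definition hzn :: "('b::real_vector \<Rightarrow> real) \<Rightarrow> 'b set" where
  "hzn h = {d. \<forall>y. h (y + d) \<le> h y}"

definition cone_convex :: "'b::real_vector set \<Rightarrow> ('a::real_vector \<Rightarrow> 'b) \<Rightarrow> bool" where
  "cone_convex K c \<longleftrightarrow>
     (\<forall>x z. \<forall>t\<in>{0..1}. t *\<^sub>R c x + (1 - t) *\<^sub>R c z - c (t *\<^sub>R x + (1 - t) *\<^sub>R z) \<in> K)"

definition pos_part :: "real \<Rightarrow> real" where
  "pos_part s = max s 0"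

text \<open>A family is a function of the smoothing parameter; its values at nonpositive
  parameters are irrelevant.\<close>

definition smoothing_approx ::
  "('b::real_inner \<Rightarrow> real) \<Rightarrow> (real \<Rightarrow> 'b \<Rightarrow> real) \<Rightarrow> real \<Rightarrow> real \<Rightarrow> real \<Rightarrow> real \<Rightarrow> bool" where
  "smoothing_approx \<phi> \<Phi> \<alpha>1 \<alpha>2 \<alpha>31 \<alpha>32 \<longleftrightarrow>
     convex_on UNIV \<phi> \<and> \<alpha>1 \<ge> 0 \<and> \<alpha>2 > 0 \<and> \<alpha>31 + \<alpha>32 > 0 \<and>
     (\<forall>\<mu>>0. convex_on UNIV (\<Phi> \<mu>) \<and> C1_fun (\<Phi> \<mu>) \<and>
            (\<alpha>1 + \<alpha>2 / \<mu>)-lipschitz_on UNIV (grad (\<Phi> \<mu>)) \<and>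
            (\<forall>y. \<phi> y - \<alpha>31 * \<mu> \<le> \<Phi> \<mu> y \<and> \<Phi> \<mu> y \<le> \<phi> y + \<alpha>32 * \<mu>))"

definition parameter_controlled :: "(real \<Rightarrow> 'b \<Rightarrow> real) \<Rightarrow> real \<Rightarrow> bool" where
  "parameter_controlled \<Phi> \<alpha>4 \<longleftrightarrow>
     \<alpha>4 \<ge> 0 \<and>
     (\<forall>\<mu>0 \<mu>1 y. 0 < \<mu>1 \<and> \<mu>1 \<le> \<mu>0 \<longrightarrow> \<Phi> \<mu>1 y \<le> \<Phi> \<mu>0 y + \<alpha>4 * (\<mu>0 - \<mu>1))"

definition psi ::
  "('a \<Rightarrow> real) \<Rightarrow> ('a \<Rightarrow> real) \<Rightarrow> ('a \<Rightarrow> real) \<Rightarrow> 'a set \<Rightarrow> 'a \<Rightarrow> ereal" where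
  "psi f P1 P2 C x = ereal (f x + P1 x - P2 x) + indicator_ext C x"

definition feasible_set :: "('a \<Rightarrow> real) \<Rightarrow> 'a set \<Rightarrow> 'a set" where
  "feasible_set g C = {x \<in> C. g x \<le> 0}"

definition opt_value :: "('a \<Rightarrow> ereal) \<Rightarrow> ('a \<Rightarrow> real) \<Rightarrow> 'a set \<Rightarrow> ereal" where
  "opt_value \<psi> g C = (INF x\<in>feasible_set g C. \<psi> x)"

definition solution_set :: "('a \<Rightarrow> ereal) \<Rightarrow> ('a \<Rightarrow> real) \<Rightarrow> 'a set \<Rightarrow> 'a set" where
  "solution_set \<psi> g C = {x \<in> feasible_set g C. \<psi> x = opt_value \<psi> g C}"

definition subproblem_objective ::
  "('a::real_inner \<Rightarrow> real) \<Rightarrow> ('a \<Rightarrow> real) \<Rightarrow> 'a set \<Rightarrow> ('a \<Rightarrow> real) \<Rightarrow> real \<Rightarrow> real \<Rightarrow>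
   'a \<Rightarrow> 'a \<Rightarrow> real \<Rightarrow> 'a \<Rightarrow> ereal" where
  "subproblem_objective f P1 C G \<gamma> \<mu> \<xi> xk L x =
     ereal (\<gamma> * ((grad f xk - \<xi>) \<bullet> x + P1 x)
            + (G xk + grad G xk \<bullet> (x - xk))
            + L / (2 * \<mu>) * (norm (x - xk))\<^sup>2)
     + indicator_ext C x"

definition trial_point ::
  "('a::real_inner \<Rightarrow> real) \<Rightarrow> ('a \<Rightarrow> real) \<Rightarrow> 'a set \<Rightarrow> ('a \<Rightarrow> real) \<Rightarrow> real \<Rightarrow> real \<Rightarrow>
   'a \<Rightarrow> 'a \<Rightarrow> real \<Rightarrow> 'a \<Rightarrow> bool" where
  "trial_point f P1 C G \<gamma> \<mu> \<xi> xk L z \<longleftrightarrow>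
     is_arg_min (subproblem_objective f P1 C G \<gamma> \<mu> \<xi> xk L) (\<lambda>_. True) z"

definition sufficient_descent ::
  "('a::real_inner \<Rightarrow> ereal) \<Rightarrow> ('a \<Rightarrow> real) \<Rightarrow> real \<Rightarrow> real \<Rightarrow> real \<Rightarrow> 'a \<Rightarrow> 'a \<Rightarrow> bool" where
  "sufficient_descent \<psi> G \<gamma> \<mu> c1 xk z \<longleftrightarrow>
     ereal \<gamma> * \<psi> z + ereal (G z)
       \<le> ereal \<gamma> * \<psi> xk + ereal (G xk) - ereal (c1 / (2 * \<mu>) * (norm (z - xk))\<^sup>2)"

text \<open>\<open>L0 k\<close> is the initial trial constant $L_{k,0}$ of iteration \<open>k\<close> and \<open>L k\<close> the accepted
  one, i.e. \<open>2 ^ i * L0 k\<close> for the first \<open>i\<close> at which the descent test succeeds.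
  \<open>\<Phi>\<close> and \<open>h\<^sub>\<mu>\<close> are the smoothings of the positive part and of \<open>h\<close>.\<close>

definition sESQM ::
  "('a::euclidean_space \<Rightarrow> real) \<Rightarrow> ('a \<Rightarrow> real) \<Rightarrow> ('a \<Rightarrow> real) \<Rightarrow> 'a set \<Rightarrow>
   ('a \<Rightarrow> 'b::euclidean_space) \<Rightarrow> (real \<Rightarrow> 'b \<Rightarrow> real) \<Rightarrow> (real \<Rightarrow> real \<Rightarrow> real) \<Rightarrow> real \<Rightarrow>
   real \<Rightarrow> real \<Rightarrow> real \<Rightarrow> real \<Rightarrow> (nat \<Rightarrow> real) \<Rightarrow>
   (nat \<Rightarrow> 'a) \<Rightarrow> (nat \<Rightarrow> 'a) \<Rightarrow> (nat \<Rightarrow> real) \<Rightarrow> (nat \<Rightarrow> real) \<Rightarrow> (nat \<Rightarrow> real) \<Rightarrow>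
   (nat \<Rightarrow> nat) \<Rightarrow> (nat \<Rightarrow> real) \<Rightarrow> bool" where
  "sESQM f P1 P2 C c h\<^sub>\<mu> \<Phi> \<alpha>3\<phi> Llow Lup c1 c2 \<gamma>hat x \<xi> L0 L \<mu> t \<gamma> \<longleftrightarrow>
     0 < Llow \<and> Llow \<le> Lup \<and> 0 < c1 \<and> 0 < c2 \<and>
     (\<forall>k. 0 < \<gamma>hat (Suc k) \<and> \<gamma>hat (Suc k) < \<gamma>hat k) \<and>
     x 0 \<in> C \<and> 0 < \<mu> 0 \<and> t 0 = 0 \<and>
     (\<forall>k. let G = (\<lambda>z. \<Phi> (\<mu> k) (h\<^sub>\<mu> (\<mu> k) (c z)));
              trial = trial_point f P1 C G (\<gamma> k) (\<mu> k) (\<xi> k) (x k);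
              descent = sufficient_descent (psi f P1 P2 C) G (\<gamma> k) (\<mu> k) c1 (x k)
          in \<xi> k \<in> limiting_subdiff (\<lambda>z. ereal (P2 z)) (x k) \<and>
             Llow \<le> L0 k \<and> L0 k \<le> Lup \<and>
             \<gamma> k = \<gamma>hat (t k) \<and>
             (\<exists>i. L k = 2 ^ i * L0 k \<and>
                  (\<forall>j<i. \<forall>z. trial (2 ^ j * L0 k) z \<longrightarrow> \<not> descent z)) \<and>
             trial (L k) (x (Suc k)) \<and> descent (x (Suc k)) \<and>
             t (Suc k) = (if h\<^sub>\<mu> (\<mu> k) (c (x (Suc k))) > 2 * \<alpha>3\<phi> * \<mu> k \<and>
                             norm (x (Suc k) - x k) \<le> c2 * \<mu> k * \<gamma> k
                          then t k + 1 else t k) \<and>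
             0 < \<mu> (Suc k) \<and> \<mu> (Suc k) \<le> \<mu> k)"

text \<open>\<open>k_bar\<close> equals \<open>-1\<close> when \<open>t\<close> is constant, hence its integer type.\<close>

definition k_bar :: "(nat \<Rightarrow> nat) \<Rightarrow> int" where
  "k_bar t = int (LEAST k. \<forall>j\<ge>k. t j = t k) - 1"

definition gamma_bar :: "(nat \<Rightarrow> nat) \<Rightarrow> (nat \<Rightarrow> real) \<Rightarrow> real" where
  "gamma_bar t \<gamma> = \<gamma> (nat (k_bar t + 1))"

text \<open>The inequality bounding the penalty function forces
  \<open>x \<in> C\<close> when \<open>\<psi>\<^sub>*\<close> is finite, so the base of the power is then a real number. Note that \<open>powr\<close> takes the absolute value of a
  negative base; negative bases do not occur when the solutions also minimize the penalty
  function \<open>\<psi> + g\<^sup>+ / \<gamma>\<close>, which is the situation in which the bound is used.\<close>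

definition error_bound ::
  "('a::euclidean_space \<Rightarrow> ereal) \<Rightarrow> ('a \<Rightarrow> real) \<Rightarrow> 'a set \<Rightarrow> real \<Rightarrow>
   real \<Rightarrow> real \<Rightarrow> real \<Rightarrow> real \<Rightarrow> bool" where
  "error_bound \<psi> g C \<gamma> \<kappa> \<theta> \<epsilon>0 \<epsilon>1 \<longleftrightarrow>
     (\<forall>x. infdist x (solution_set \<psi> g C) \<le> \<epsilon>0 \<and>
          \<psi> x + ereal (inverse \<gamma> * pos_part (g x)) \<le> opt_value \<psi> g C + ereal \<epsilon>1 \<longrightarrow>
          infdist x (solution_set \<psi> g C)
            \<le> \<kappa> * real_of_ereal (\<psi> x + ereal (inverse \<gamma> * pos_part (g x)) - opt_value \<psi> g C)
                    powr (1 - \<theta>))"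

end

theory Submission
  imports Defs
begin

text \<open>
  At iteration \<open>k\<close> the algorithm decreases the merit function
  \<open>E\<^sub>k = \<gamma>\<^sub>k \<psi> + g\<^sub>\<mu>\<close>, which differs by \<open>O(\<mu>\<^sub>k)\<close> from the penalty function
  \<open>F = \<gamma> \<psi> + g\<^sup>+\<close> with \<open>\<gamma> = \<gamma>\<^sub>k\<close>. The argument has three stages.

  \<^bold>\<open>The penalty parameter settles.\<close> An increment of \<open>t\<close> requires a step of length at most
  \<open>c\<^sub>2 \<mu>\<^sub>k \<gamma>\<^sub>k\<close> that ends at a point violating the smoothed constraint by more than
  \<open>2 \<alpha>\<^sub>3 \<mu>\<^sub>k\<close>. If this happened infinitely often, then \<open>\<gamma>\<^sub>k \<rightarrow> 0\<close>; in the optimality condition of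
  the subproblem the objective and the proximal term would disappear, while the violation keeps
  the slope of the smoothed positive part at least \<open>1/3\<close>. Dividing by this slope and passing to a
  limit point produces a point with \<open>g \<ge> 0\<close> that is critical for \<open>g\<close> on \<open>C\<close>, which the constraint
  qualification excludes (\<open>penalty_parameter_freezes\<close>).

  \<^bold>\<open>The iterates converge.\<close> Once \<open>\<gamma>\<close> is constant, the shifted merit values
  \<open>u\<^sub>k = E\<^sub>k(x\<^sub>k) + const \<mu>\<^sub>k - min F\<close> are nonnegative and decreasing. Strong convexity of the
  subproblem gives, for each minimizer \<open>z\<close> of \<open>F\<close> on \<open>C\<close>,
  \<open>|z - x\<^sub>k\<^sub>+\<^sub>1|\<^sup>2 \<le> |z - x\<^sub>k|\<^sup>2 - a \<mu>\<^sub>k u\<^sub>k\<^sub>+\<^sub>1 + B \<mu>\<^sub>k\<^sup>2 + B \<mu>\<^sub>k (u\<^sub>k - u\<^sub>k\<^sub>+\<^sub>1)\<close> (\<open>distance_inequality\<close>).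
  The errors are summable because \<open>\<mu>\<^sub>k\<close> is of order \<open>k\<^sup>-\<^sup>r\<close> with \<open>r > 1/2\<close>, and adding their tails to the
  squared distance gives a decreasing potential. As \<open>\<Sum> \<mu>\<^sub>k = \<infinity>\<close>, it follows that
  \<open>u\<^sub>k \<rightarrow> 0\<close>. Steps longer than \<open>c\<^sub>2 \<mu>\<^sub>k \<gamma>\<close> cost a fixed multiple of \<open>\<mu>\<^sub>k\<close> of merit, so short steps recur;
  as \<open>t\<close> no longer changes, short steps end at almost feasible points. A limit point of these is
  feasible and minimizes \<open>F\<close>; hence the whole sequence converges to it. It also follows that
  \<open>\<gamma>\<close> is an exact penalty parameter, so that the limit solves the problem and all solutions
  minimize \<open>F\<close> (\<open>converges_to_feasible_minimizer\<close>, \<open>convergence_rate_to_solution\<close>).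

  \<^bold>\<open>The rate.\<close> With \<open>D\<^sub>k\<close> the distance of \<open>x\<^sub>k\<close> to the solution set, put
  \<open>W\<^sub>k = D\<^sub>k\<^sup>2 + B \<mu>\<^sub>k u\<^sub>k\<close>. The error bound gives \<open>u\<^sub>k \<ge> const W\<^sub>k\<^sup>p\<close> with some \<open>p > 1\<close>, and the distance
  inequality at the projection of \<open>x\<^sub>k\<close> becomes
  \<open>W\<^sub>k\<^sub>+\<^sub>1 \<le> W\<^sub>k - a' \<mu>\<^sub>k W\<^sub>k\<^sub>+\<^sub>1\<^sup>p + B \<mu>\<^sub>k\<^sup>2\<close>. Its solutions are \<open>O(k\<^sup>-\<^sup>\<sigma>)\<close> as soon as
  \<open>\<sigma> \<le> 2r - 1\<close> and \<open>\<sigma> (p - 1) \<le> 1 - r\<close> (\<open>superlinear_recursion_rate\<close>). The monotone potential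
  turns this into \<open>|x\<^sub>k - lim x| = O(k\<^sup>-\<^sup>\<sigma>\<^sup>/\<^sup>2)\<close>. For \<open>\<theta> > 1/2\<close> the exponent is
  \<open>p = 1 / (2 (1 - \<theta>))\<close>. For \<open>\<theta> \<le> 1/2\<close> the error bound would allow \<open>p = 1\<close>, but
  the weaker bound with \<open>p = r / (2r - 1)\<close> already gives \<open>\<sigma> = 2r - 1\<close>, so that both
  cases are instances of one recursion.
\<close>

section \<open>Derivatives, convexity and linearization\<close>

text \<open>\<open>grad\<close> is a definite description, so it denotes the gradient only where a Riesz representative
  of the derivative exists and is unique; the adjoint evaluated at \<open>1\<close> is that representative.\<close>

lemma grad_eqI:
  fixes F :: "'a::euclidean_space \<Rightarrow> real"
  assumes "(F has_derivative F') (at x)"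
  shows "grad F x \<bullet> d = F' d"
proof -
  have lin: "linear F'" using assms by (simp add: has_derivative_linear)
  define D where "D = adjoint F' 1"
  have D: "F' = (\<lambda>d. d \<bullet> D)"
    using adjoint_works[OF lin, of _ 1] by (auto simp: D_def)
  have "GDERIV F x :> D" using assms unfolding gderiv_def D by simp
  moreover have "D' = D" if "GDERIV F x :> D'" for D'
  proof -
    have "(\<lambda>d. d \<bullet> D') = (\<lambda>d. d \<bullet> D)"
      using that assms unfolding gderiv_def D by (rule has_derivative_unique)
    then have "d \<bullet> (D' - D) = 0" for d by (metis inner_diff_right eq_iff_diff_eq_0)
    then show ?thesis by (metis inner_eq_zero_iff eq_iff_diff_eq_0)
  qed
  ultimately have "grad F x = D" unfolding grad_def by (rule the_equality)
  then show ?thesis by (simp add: D inner_commute)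
qed

lemma C1_fun_total_deriv:
  assumes "C1_fun F"
  shows "(F has_derivative blinfun_apply (total_deriv F x)) (at x)"
proof -
  have "(F has_derivative frechet_derivative F (at x)) (at x)"
    using assms frechet_derivative_works by (auto simp: C1_fun_def)
  then show ?thesis
    unfolding total_deriv_def
    by (simp add: bounded_linear_Blinfun_apply has_derivative_bounded_linear)
qed

lemma C1_fun_grad_total_deriv:
  fixes F :: "'a::euclidean_space \<Rightarrow> real"
  assumes "C1_fun F"
  shows "grad F x \<bullet> d = total_deriv F x d"
  by (rule grad_eqI[OF C1_fun_total_deriv[OF assms]])

lemma C1_fun_grad:
  fixes F :: "'a::euclidean_space \<Rightarrow> real"
  assumes "C1_fun F"
  shows "(F has_derivative (\<lambda>d. grad F x \<bullet> d)) (at x)"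
  using C1_fun_total_deriv[OF assms, of x] C1_fun_grad_total_deriv[OF assms, of x]
  by simp

text \<open>Restriction to the line through \<open>x\<close> and \<open>y\<close> reduces the claim to the tangent of a convex
  function of one real variable.\<close>

lemma convex_above_derivative:
  fixes F :: "'a::real_normed_vector \<Rightarrow> real"
  assumes conv: "convex_on UNIV F" and deriv: "(F has_derivative F') (at x)"
  shows "F x + F' (y - x) \<le> F y"
proof -
  define G where "G s = F (x + s *\<^sub>R (y - x))" for s :: real
  have "convex_on UNIV G"
  proof (rule convex_onI)
    fix t a b :: real assume t: "0 < t" "t < 1"
    have "x + ((1 - t) *\<^sub>R a + t *\<^sub>R b) *\<^sub>R (y - x)
        = (1 - t) *\<^sub>R (x + a *\<^sub>R (y - x)) + t *\<^sub>R (x + b *\<^sub>R (y - x))"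
      by (simp add: algebra_simps)
    then show "G ((1 - t) *\<^sub>R a + t *\<^sub>R b) \<le> (1 - t) * G a + t * G b"
      unfolding G_def using convex_onD[OF conv, of t] t by simp
  qed auto
  moreover have "(G has_field_derivative F' (y - x)) (at 0)"
  proof -
    have "(F has_derivative F') (at (x + 0 *\<^sub>R (y - x)))"
      using deriv by simp
    then have "((\<lambda>s. F (x + s *\<^sub>R (y - x))) has_derivative (\<lambda>s. F' (s *\<^sub>R (y - x)))) (at 0)"
      by (intro has_derivative_compose[where g = F and f = "\<lambda>s. x + s *\<^sub>R (y - x)"])
         (auto intro!: derivative_eq_intros)
    moreover have "F' (s *\<^sub>R (y - x)) = F' (y - x) * s" for s
      using has_derivative_linear[OF deriv] by (simp add: linear_cmul)
    ultimately show ?thesis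
      by (simp add: has_field_derivative_def G_def[abs_def])
  qed
  ultimately have "G 1 - G 0 \<ge> F' (y - x) * (1 - 0)"
    by (intro convex_on_imp_above_tangent[where A = UNIV]) auto
  then show ?thesis by (simp add: G_def)
qed

lemma convex_above_tangent_plane:
  fixes F :: "'a::euclidean_space \<Rightarrow> real"
  assumes "convex_on UNIV F" "C1_fun F"
  shows "F x + grad F x \<bullet> (y - x) \<le> F y"
  using convex_above_derivative[OF assms(1) C1_fun_grad[OF assms(2)]] .

text \<open>A convex function grows along a ray at least as fast as its slope at the origin of the ray. So an
  upper bound of the form "linear plus constant" on the ray controls the slope, and the constant is
  lost after division by \<open>s \<rightarrow> \<infinity>\<close>. This is how smoothings inherit Lipschitz constants, monotonicity
  and recession directions from the function that they approximate within a constant.\<close>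

lemma linear_growth_bounds_slope:
  fixes F :: "'a::euclidean_space \<Rightarrow> real"
  assumes conv: "convex_on UNIV F" and C1: "C1_fun F"
    and growth: "\<And>s. s > 0 \<Longrightarrow> F (y + s *\<^sub>R d) \<le> F y + s * M + K"
  shows "grad F y \<bullet> d \<le> M"
proof (rule field_le_epsilon)
  fix e :: real assume "e > 0"
  \<comment> \<open>Far enough out on the ray for the constant to be below \<open>e\<close> times the distance.\<close>
  define s where "s = (\<bar>K\<bar> + 1) / e"
  have s: "s > 0" "K \<le> s * e" using \<open>e > 0\<close> by (auto simp: s_def)
  have "s * (grad F y \<bullet> d) \<le> F (y + s *\<^sub>R d) - F y"
    using convex_above_tangent_plane[OF conv C1, of y "y + s *\<^sub>R d"] by simp
  also have "\<dots> \<le> s * (M + e)" using growth[of s] s by (simp add: algebra_simps)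
  finally show "grad F y \<bullet> d \<le> M + e" using s(1) by simp
qed

text \<open>Mean value inequality for \<open>F - F' a\<close> on the segment. The integral form of the remainder would
  give the constant \<open>K / 2\<close>; a factor in curvature constants does not affect any exponent.\<close>

lemma linearization_error:
  fixes F :: "'a::real_normed_vector \<Rightarrow> 'b::real_normed_vector"
  assumes S: "convex S" "a \<in> S" "b \<in> S"
    and deriv: "\<And>z. z \<in> S \<Longrightarrow> (F has_derivative F' z) (at z)"
    and lip: "\<And>z d. z \<in> S \<Longrightarrow> norm (F' z d - F' a d) \<le> K * norm (z - a) * norm d"
    and K: "K \<ge> 0"
  shows "norm (F b - F a - F' a (b - a)) \<le> K * (norm (b - a))\<^sup>2"
proof -
  have "norm (F b - F a - F' a (b - a)) \<le> norm (b - a) * (K * norm (b - a))"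
  proof (rule differentiable_bound_linearization[where S = "closed_segment a b"])
    fix z assume z: "z \<in> closed_segment a b"
    have zS: "z \<in> S" using z S closed_segment_subset by blast
    show "(F has_derivative F' z) (at z within closed_segment a b)"
      using deriv[OF zS] by (rule has_derivative_at_withinI)
    have "norm (z - a) \<le> norm (b - a)"
      using segment_bound(1)[OF z] by simp
    then have "norm (F' z d - F' a d) \<le> K * norm (b - a) * norm d" for d
      using lip[OF zS, of d] K
      by (meson order_trans mult_right_mono mult_left_mono norm_ge_zero)
    then have "norm ((F' z - F' a) d) \<le> K * norm (b - a) * norm d" for d
      by (simp add: fun_diff_def)
    then show "onorm (F' z - F' a) \<le> K * norm (b - a)"
      using K by (intro onorm_bound) auto
  next
    show "\<And>t. t \<in> {0..1} \<Longrightarrow> a + t *\<^sub>R (b - a) \<in> closed_segment a b"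
      by (force simp: closed_segment_def algebra_simps)
  qed auto
  then show ?thesis by (simp add: power2_eq_square mult_ac)
qed

lemma smooth_on_set_linearization_error:
  fixes F :: "'a::real_normed_vector \<Rightarrow> 'b::real_normed_vector"
  assumes "C1_fun F" "smooth_on_set K C F" "convex C" "a \<in> C" "b \<in> C"
  shows "norm (F b - F a - total_deriv F a (b - a)) \<le> K * (norm (b - a))\<^sup>2"
proof (rule linearization_error[where S = C])
  have lip: "K-lipschitz_on C (total_deriv F)" using assms(2) by (simp add: smooth_on_set_def)
  show "K \<ge> 0" using lip by (rule lipschitz_on_nonneg)
  fix z d assume z: "z \<in> C"
  show "(F has_derivative blinfun_apply (total_deriv F z)) (at z)"
    using assms(1) by (rule C1_fun_total_deriv)
  have "norm (total_deriv F z d - total_deriv F a d) \<le> norm (total_deriv F z - total_deriv F a) * norm d"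
    by (metis blinfun.diff_left norm_blinfun)
  also have "\<dots> \<le> K * norm (z - a) * norm d"
    using lipschitz_onD[OF lip z assms(4)] by (intro mult_right_mono) (auto simp: dist_norm)
  finally show "norm (total_deriv F z d - total_deriv F a d) \<le> K * norm (z - a) * norm d" .
qed (use assms in auto)

lemma lipschitz_grad_upper_bound:
  fixes F :: "'a::euclidean_space \<Rightarrow> real"
  assumes "C1_fun F" "K-lipschitz_on UNIV (grad F)"
  shows "F b \<le> F a + grad F a \<bullet> (b - a) + K * (norm (b - a))\<^sup>2"
proof -
  have "norm (F b - F a - grad F a \<bullet> (b - a)) \<le> K * (norm (b - a))\<^sup>2"
  proof (rule linearization_error[where S = UNIV and F' = "\<lambda>z d. grad F z \<bullet> d"])
    fix z d :: 'a
    show "(F has_derivative (\<lambda>d. grad F z \<bullet> d)) (at z)" using assms(1) by (rule C1_fun_grad)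
    have "norm (grad F z \<bullet> d - grad F a \<bullet> d) \<le> norm (grad F z - grad F a) * norm d"
      by (simp flip: inner_diff_left add: Cauchy_Schwarz_ineq2)
    also have "\<dots> \<le> K * norm (z - a) * norm d"
      using lipschitz_onD[OF assms(2), of z a] by (intro mult_right_mono) (auto simp: dist_norm)
    finally show "norm (grad F z \<bullet> d - grad F a \<bullet> d) \<le> K * norm (z - a) * norm d" .
    show "0 \<le> K" using assms(2) by (rule lipschitz_on_nonneg)
  qed auto
  then show ?thesis by (auto simp: abs_le_iff)
qed

text \<open>The quadratic term makes the objective strongly convex, so the minimal value is exceeded by at
  least a multiple of the squared distance to the minimizer. Comparing \<open>w\<close> with a point of the
  segment from \<open>w\<close> to \<open>z\<close> and letting it tend to \<open>w\<close> proves this without subgradients of \<open>J\<close>.\<close>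

lemma strongly_convex_minimizer:
  fixes J :: "'a::real_inner \<Rightarrow> real"
  assumes J: "convex_on C J"
    and min: "w \<in> C" "\<And>z. z \<in> C \<Longrightarrow> J w + l * (norm (w - y))\<^sup>2 \<le> J z + l * (norm (z - y))\<^sup>2"
    and z: "z \<in> C"
  shows "J w + l * (norm (w - y))\<^sup>2 + l * (norm (z - w))\<^sup>2 \<le> J z + l * (norm (z - y))\<^sup>2"
proof -
  have *: "J w + l * (norm (w - y))\<^sup>2 + (1 - t) * (l * (norm (z - w))\<^sup>2) \<le> J z + l * (norm (z - y))\<^sup>2"
    if t: "0 < t" "t < 1" for t :: real
  proof -
    define v where "v = (1 - t) *\<^sub>R w + t *\<^sub>R z"
    have v: "v \<in> C" using convexD_alt[of C w z t] J min(1) z t by (simp add: v_def convex_on_def)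
    have nv: "(norm (v - y))\<^sup>2 = (1 - t) * (norm (w - y))\<^sup>2 + t * (norm (z - y))\<^sup>2 - t * (1 - t) * (norm (z - w))\<^sup>2"
      unfolding v_def power2_norm_eq_inner by (simp add: algebra_simps inner_commute)
    have "J v \<le> (1 - t) * J w + t * J z"
      unfolding v_def using J t min(1) z by (auto intro!: convex_onD)
    with min(2)[OF v] have "t * (J w + l * (norm (w - y))\<^sup>2 + (1 - t) * (l * (norm (z - w))\<^sup>2))
         \<le> t * (J z + l * (norm (z - y))\<^sup>2)"
      unfolding nv by (simp add: algebra_simps)
    then show ?thesis using t by simp
  qed
  have "((\<lambda>t. J w + l * (norm (w - y))\<^sup>2 + (1 - t) * (l * (norm (z - w))\<^sup>2)) \<longlongrightarrow>
      J w + l * (norm (w - y))\<^sup>2 + (1 - 0) * (l * (norm (z - w))\<^sup>2)) (at_right 0)"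
    by (intro tendsto_intros)
  moreover have "eventually (\<lambda>t. J w + l * (norm (w - y))\<^sup>2 + (1 - t) * (l * (norm (z - w))\<^sup>2) \<le> J z + l * (norm (z - y))\<^sup>2) (at_right (0::real))"
    unfolding eventually_at_right_field using * by (intro exI[of _ 1]) auto
  ultimately show ?thesis using tendsto_upperbound[of _ _ "at_right (0::real)"] by force
qed

section \<open>The smoothed constraint\<close>

locale smoothed_composite =
  fixes C :: "'a::euclidean_space set"
    and c :: "'a \<Rightarrow> 'b::euclidean_space"
    and h :: "'b \<Rightarrow> real"
    and h\<^sub>\<mu> :: "real \<Rightarrow> 'b \<Rightarrow> real"
    and \<Phi> :: "real \<Rightarrow> real \<Rightarrow> real"
    and L\<^sub>c M\<^sub>c M\<^sub>h :: real
    and \<alpha>1h \<alpha>2h \<alpha>31h \<alpha>32h \<alpha>4h \<alpha>1\<phi> \<alpha>2\<phi> \<alpha>31\<phi> \<alpha>32\<phi> \<alpha>4\<phi> :: real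
  assumes C: "compact C" "convex C"
    and c: "C1_fun c" "L\<^sub>c \<ge> 0" "smooth_on_set L\<^sub>c C c" "M\<^sub>c > 0" "M\<^sub>c-lipschitz_on C c"
    and h: "convex_on UNIV h" "M\<^sub>h > 0" "M\<^sub>h-lipschitz_on UNIV h"
    and SA_h: "smoothing_approx h h\<^sub>\<mu> \<alpha>1h \<alpha>2h \<alpha>31h \<alpha>32h" "parameter_controlled h\<^sub>\<mu> \<alpha>4h"
    and SA_\<phi>: "smoothing_approx pos_part \<Phi> \<alpha>1\<phi> \<alpha>2\<phi> \<alpha>31\<phi> \<alpha>32\<phi>" "parameter_controlled \<Phi> \<alpha>4\<phi>"
begin

definition g\<^sub>\<mu> :: "real \<Rightarrow> 'a \<Rightarrow> real" where
  "g\<^sub>\<mu> m z = \<Phi> m (h\<^sub>\<mu> m (c z))"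

lemma h\<^sub>\<mu>_smooth:
  assumes "m > 0"
  shows "convex_on UNIV (h\<^sub>\<mu> m)" "C1_fun (h\<^sub>\<mu> m)"
    "(\<alpha>1h + \<alpha>2h / m)-lipschitz_on UNIV (grad (h\<^sub>\<mu> m))"
    "h y - \<alpha>31h * m \<le> h\<^sub>\<mu> m y" "h\<^sub>\<mu> m y \<le> h y + \<alpha>32h * m"
  using SA_h(1) assms by (auto simp: smoothing_approx_def)

lemma \<Phi>_smooth:
  assumes "m > 0"
  shows "convex_on UNIV (\<Phi> m)" "C1_fun (\<Phi> m)"
    "(\<alpha>1\<phi> + \<alpha>2\<phi> / m)-lipschitz_on UNIV (grad (\<Phi> m))"
    "pos_part s - \<alpha>31\<phi> * m \<le> \<Phi> m s" "\<Phi> m s \<le> pos_part s + \<alpha>32\<phi> * m"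
  using SA_\<phi>(1) assms by (auto simp: smoothing_approx_def)

lemma \<alpha>3\<phi>_pos: "\<alpha>31\<phi> + \<alpha>32\<phi> > 0"
  using SA_\<phi>(1) by (auto simp: smoothing_approx_def)

lemma h_lip: "\<bar>h y - h z\<bar> \<le> M\<^sub>h * norm (y - z)"
  using lipschitz_onD[OF h(3), of y z] by (simp add: dist_norm)

lemma c_lip: "y \<in> C \<Longrightarrow> z \<in> C \<Longrightarrow> norm (c y - c z) \<le> M\<^sub>c * norm (y - z)"
  using lipschitz_onD[OF c(5), of y z] by (simp add: dist_norm)

lemma continuous_h: "continuous_on S h"
  using lipschitz_on_continuous_on[OF h(3)] continuous_on_subset by blast

lemma continuous_C1: "C1_fun F \<Longrightarrow> continuous_on S F"
  by (meson C1_fun_def continuous_at_imp_continuous_on differentiable_imp_continuous_within)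

lemma continuous_c: "continuous_on S c"
  using c(1) by (rule continuous_C1)

lemma continuous_hc: "continuous_on S (\<lambda>z. h (c z))"
  by (rule continuous_on_compose2[OF continuous_h[of UNIV] continuous_c]) auto

text \<open>The smoothing stays within a constant of the Lipschitz function \<open>h\<close>, so along the ray in direction
  \<open>d = \<nabla>h\<^sub>\<mu>(y)\<close> it grows at most with slope \<open>M\<^sub>h |d|\<close>; hence \<open>d \<bullet> d \<le> M\<^sub>h |d|\<close>.\<close>

lemma grad_h\<^sub>\<mu>_bound:
  assumes m: "m > 0"
  shows "norm (grad (h\<^sub>\<mu> m) y) \<le> M\<^sub>h"
proof -
  define d where "d = grad (h\<^sub>\<mu> m) y"
  have "d \<bullet> d \<le> M\<^sub>h * norm d"
    unfolding d_def[symmetric]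
  proof (subst (1) d_def, rule linear_growth_bounds_slope[OF h\<^sub>\<mu>_smooth(1,2)[OF m]])
    fix s :: real assume "s > 0"
    then have "h (y + s *\<^sub>R d) \<le> h y + s * (M\<^sub>h * norm d)"
      using h_lip[of "y + s *\<^sub>R d" y] by (simp add: mult_ac abs_le_iff)
    then show "h\<^sub>\<mu> m (y + s *\<^sub>R d) \<le> h\<^sub>\<mu> m y + s * (M\<^sub>h * norm d) + (\<alpha>31h + \<alpha>32h) * m"
      using h\<^sub>\<mu>_smooth(5)[OF m, of "y + s *\<^sub>R d"] h\<^sub>\<mu>_smooth(4)[OF m, of y]
      by (simp add: algebra_simps)
  qed
  then have "norm d * norm d \<le> M\<^sub>h * norm d" by (metis power2_eq_square power2_norm_eq_inner)
  then show ?thesis unfolding d_def[symmetric] using h(2)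
    by (cases "norm d = 0") (auto simp: mult_le_cancel_right)
qed

lemma h\<^sub>\<mu>_lip:
  assumes m: "m > 0"
  shows "h\<^sub>\<mu> m y - h\<^sub>\<mu> m z \<le> M\<^sub>h * norm (y - z)"
proof -
  have "h\<^sub>\<mu> m y - h\<^sub>\<mu> m z \<le> grad (h\<^sub>\<mu> m) y \<bullet> (y - z)"
    using convex_above_tangent_plane[OF h\<^sub>\<mu>_smooth(1,2)[OF m], of y z] by (simp add: inner_diff_right)
  also have "\<dots> \<le> norm (grad (h\<^sub>\<mu> m) y) * norm (y - z)" by (rule norm_cauchy_schwarz)
  also have "\<dots> \<le> M\<^sub>h * norm (y - z)" using grad_h\<^sub>\<mu>_bound[OF m] by (intro mult_right_mono) auto
  finally show ?thesis .
qed

text \<open>The positive part grows with slope at most \<open>1\<close> to the right and is bounded to the left.\<close>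

lemma grad_\<Phi>_bounds:
  assumes m: "m > 0"
  shows "0 \<le> grad (\<Phi> m) s" "grad (\<Phi> m) s \<le> 1"
proof -
  have "grad (\<Phi> m) s \<bullet> (-1) \<le> 0"
  proof (rule linear_growth_bounds_slope[OF \<Phi>_smooth(1,2)[OF m]])
    fix e :: real assume "e > 0"
    then have "pos_part (s + e *\<^sub>R (-1)) \<le> pos_part s" by (simp add: pos_part_def)
    then show "\<Phi> m (s + e *\<^sub>R (-1)) \<le> \<Phi> m s + e * 0 + (\<alpha>31\<phi> + \<alpha>32\<phi>) * m"
      using \<Phi>_smooth(5)[OF m, of "s + e *\<^sub>R (-1)"] \<Phi>_smooth(4)[OF m, of s]
      by (simp add: algebra_simps)
  qed
  then show "0 \<le> grad (\<Phi> m) s" by simp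
  have "grad (\<Phi> m) s \<bullet> 1 \<le> 1"
  proof (rule linear_growth_bounds_slope[OF \<Phi>_smooth(1,2)[OF m]])
    fix e :: real assume "e > 0"
    then have "pos_part (s + e *\<^sub>R 1) \<le> pos_part s + e" by (simp add: pos_part_def)
    then show "\<Phi> m (s + e *\<^sub>R 1) \<le> \<Phi> m s + e * 1 + (\<alpha>31\<phi> + \<alpha>32\<phi>) * m"
      using \<Phi>_smooth(5)[OF m, of "s + e *\<^sub>R 1"] \<Phi>_smooth(4)[OF m, of s]
      by (simp add: algebra_simps)
  qed
  then show "grad (\<Phi> m) s \<le> 1" by simp
qed

lemma \<Phi>_mono:
  assumes m: "m > 0" and "s \<le> t"
  shows "\<Phi> m s \<le> \<Phi> m t"
proof -
  have "0 \<le> grad (\<Phi> m) s * (t - s)" using assms grad_\<Phi>_bounds(1)[OF m] by simp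
  then show ?thesis
    using convex_above_tangent_plane[OF \<Phi>_smooth(1,2)[OF m], of s t] by simp
qed

lemma \<Phi>_nonexpansive:
  assumes m: "m > 0" and "0 \<le> e"
  shows "\<Phi> m (s + e) \<le> \<Phi> m s + e"
proof -
  have "\<Phi> m (s + e) + grad (\<Phi> m) (s + e) * (s - (s + e)) \<le> \<Phi> m s"
    using convex_above_tangent_plane[OF \<Phi>_smooth(1,2)[OF m], of "s + e" s] by simp
  moreover have "grad (\<Phi> m) (s + e) * e \<le> 1 * e"
    using assms grad_\<Phi>_bounds(2)[OF m] by (intro mult_right_mono) auto
  ultimately show ?thesis by simp
qed

text \<open>Between \<open>0\<close> and \<open>s\<close> the smoothing rises by at least \<open>s - \<alpha>\<^sub>3 m\<close>, and by convexity its slope at \<open>s\<close> is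
  at least the mean slope \<open>1 - \<alpha>\<^sub>3 m / s\<close>.\<close>

lemma grad_\<Phi>_lower:
  assumes m: "m > 0" and s: "s \<ge> 3/2 * ((\<alpha>31\<phi> + \<alpha>32\<phi>) * m)"
  shows "grad (\<Phi> m) s \<ge> 1/3"
proof -
  have *: "(\<alpha>31\<phi> + \<alpha>32\<phi>) * m > 0" using \<alpha>3\<phi>_pos m by simp
  have s0: "s > 0" using s * by linarith
  have "\<Phi> m s + grad (\<Phi> m) s * (0 - s) \<le> \<Phi> m 0"
    using convex_above_tangent_plane[OF \<Phi>_smooth(1,2)[OF m], of s 0] by simp
  then have "s - (\<alpha>31\<phi> + \<alpha>32\<phi>) * m \<le> grad (\<Phi> m) s * s"
    using \<Phi>_smooth(4)[OF m, of s] \<Phi>_smooth(5)[OF m, of 0] s0 by (simp add: pos_part_def algebra_simps)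
  then have "(1/3) * s \<le> grad (\<Phi> m) s * s" using s by linarith
  then show ?thesis using s0 by (simp only: mult_le_cancel_right)
qed

lemma g\<^sub>\<mu>_has_derivative:
  assumes m: "m > 0"
  shows "(g\<^sub>\<mu> m has_derivative
     (\<lambda>d. grad (\<Phi> m) (h\<^sub>\<mu> m (c z)) * (grad (h\<^sub>\<mu> m) (c z) \<bullet> total_deriv c z d))) (at z)"
proof -
  have "((\<lambda>z. h\<^sub>\<mu> m (c z)) has_derivative (\<lambda>d. grad (h\<^sub>\<mu> m) (c z) \<bullet> total_deriv c z d)) (at z)"
    using has_derivative_compose[OF C1_fun_total_deriv[OF c(1)] C1_fun_grad[OF h\<^sub>\<mu>_smooth(2)[OF m]]] .
  from has_derivative_compose[OF this C1_fun_grad[OF \<Phi>_smooth(2)[OF m]]]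
  show ?thesis by (simp add: g\<^sub>\<mu>_def[abs_def])
qed

lemma grad_g\<^sub>\<mu>:
  assumes m: "m > 0"
  shows "grad (g\<^sub>\<mu> m) z \<bullet> d = grad (\<Phi> m) (h\<^sub>\<mu> m (c z)) * (grad (h\<^sub>\<mu> m) (c z) \<bullet> total_deriv c z d)"
  by (rule grad_eqI[OF g\<^sub>\<mu>_has_derivative[OF m]])

text \<open>Multiplied by \<open>1 / m\<close>, this bounds the curvature of \<open>g\<^sub>\<mu> m\<close> for all \<open>m \<le> m0\<close>: the three summands
  come from the curvatures of \<open>\<Phi>\<close>, \<open>c\<close> and \<open>h\<^sub>\<mu>\<close> in this order.\<close>

definition constraint_curvature :: "real \<Rightarrow> real" where
  "constraint_curvature m0 = (\<alpha>1\<phi> * m0 + \<alpha>2\<phi>) * (M\<^sub>h * M\<^sub>c)\<^sup>2 + M\<^sub>h * L\<^sub>c * m0 + (\<alpha>1h * m0 + \<alpha>2h) * M\<^sub>c\<^sup>2"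

text \<open>The upper models of the two convex outer functions are composed directly. Only the Lipschitz
  constant of \<open>c\<close> on \<open>C\<close> is available, which does not bound its derivative in directions that leave
  \<open>C\<close>; hence differences \<open>c z - c x\<close> are estimated rather than \<open>total_deriv c\<close>, and no Lipschitz
  constant of the gradient of \<open>g\<^sub>\<mu>\<close> is claimed.\<close>

lemma g\<^sub>\<mu>_quadratic_upper_bound:
  assumes m: "0 < m" "m \<le> m0" and xz: "x \<in> C" "z \<in> C"
  shows "g\<^sub>\<mu> m z \<le> g\<^sub>\<mu> m x + grad (g\<^sub>\<mu> m) x \<bullet> (z - x) + constraint_curvature m0 / m * (norm (z - x))\<^sup>2"
proof -
  define u v g D e where "u = h\<^sub>\<mu> m (c x)" and "v = h\<^sub>\<mu> m (c z)"
    and "g = grad (h\<^sub>\<mu> m) (c x)" and "D = total_deriv c x (z - x)" and "e = (norm (z - x))\<^sup>2"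
  have \<alpha>: "\<alpha>1h \<ge> 0" "\<alpha>2h > 0" "\<alpha>1\<phi> \<ge> 0" "\<alpha>2\<phi> > 0"
    using SA_h(1) SA_\<phi>(1) by (auto simp: smoothing_approx_def)
  have cc: "norm (c z - c x) \<le> M\<^sub>c * norm (z - x)" using c_lip xz by blast
  have cc2: "(norm (c z - c x))\<^sup>2 \<le> M\<^sub>c\<^sup>2 * e"
    using power_mono[OF cc, of 2] by (simp add: e_def power_mult_distrib)
  have "v \<le> u + g \<bullet> (c z - c x) + (\<alpha>1h + \<alpha>2h / m) * (norm (c z - c x))\<^sup>2"
    unfolding v_def u_def g_def
    using lipschitz_grad_upper_bound[OF h\<^sub>\<mu>_smooth(2,3)[OF m(1)]] .
  also have "(\<alpha>1h + \<alpha>2h / m) * (norm (c z - c x))\<^sup>2 \<le> (\<alpha>1h + \<alpha>2h / m) * (M\<^sub>c\<^sup>2 * e)"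
    using cc2 \<alpha> m by (intro mult_left_mono) auto
  also have "g \<bullet> (c z - c x) \<le> g \<bullet> D + M\<^sub>h * (L\<^sub>c * e)"
  proof -
    have "g \<bullet> (c z - c x) - g \<bullet> D = g \<bullet> (c z - c x - D)" by (simp add: inner_diff_right)
    also have "\<dots> \<le> norm g * norm (c z - c x - D)" by (rule norm_cauchy_schwarz)
    also have "\<dots> \<le> M\<^sub>h * (L\<^sub>c * e)"
      unfolding D_def e_def g_def using h(2)
      by (intro mult_mono grad_h\<^sub>\<mu>_bound m smooth_on_set_linearization_error[OF c(1,3)] C xz) auto
    finally show ?thesis by simp
  qed
  finally have vu: "v - u \<le> g \<bullet> D + (M\<^sub>h * L\<^sub>c + (\<alpha>1h + \<alpha>2h / m) * M\<^sub>c\<^sup>2) * e"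
    by (simp add: algebra_simps)
  define w where "w = (M\<^sub>h * L\<^sub>c + (\<alpha>1h + \<alpha>2h / m) * M\<^sub>c\<^sup>2) * e"
  have "w \<ge> 0" unfolding w_def e_def using h(2) c(2) \<alpha> m by (intro mult_nonneg_nonneg add_nonneg_nonneg) auto
  have "\<bar>v - u\<bar> \<le> M\<^sub>h * norm (c z - c x)"
    using h\<^sub>\<mu>_lip[OF m(1), of "c z" "c x"] h\<^sub>\<mu>_lip[OF m(1), of "c x" "c z"]
    by (auto simp: u_def v_def abs_le_iff norm_minus_commute)
  also have "\<dots> \<le> M\<^sub>h * (M\<^sub>c * norm (z - x))" using cc h(2) by (intro mult_left_mono) auto
  finally have "\<bar>v - u\<bar>\<^sup>2 \<le> (M\<^sub>h * (M\<^sub>c * norm (z - x)))\<^sup>2" by (intro power_mono) auto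
  then have vu2: "(v - u)\<^sup>2 \<le> (M\<^sub>h * M\<^sub>c)\<^sup>2 * e" by (simp add: e_def power_mult_distrib)
  define p where "p = grad (\<Phi> m) u"
  have p: "0 \<le> p" "p \<le> 1" using grad_\<Phi>_bounds[OF m(1)] by (auto simp: p_def)
  have "\<Phi> m v \<le> \<Phi> m u + p * (v - u) + (\<alpha>1\<phi> + \<alpha>2\<phi> / m) * (v - u)\<^sup>2"
    using lipschitz_grad_upper_bound[OF \<Phi>_smooth(2,3)[OF m(1)], of v u] by (simp add: p_def)
  also have "(\<alpha>1\<phi> + \<alpha>2\<phi> / m) * (v - u)\<^sup>2 \<le> (\<alpha>1\<phi> + \<alpha>2\<phi> / m) * ((M\<^sub>h * M\<^sub>c)\<^sup>2 * e)"
    using vu2 \<alpha> m by (intro mult_left_mono) auto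
  also have "p * (v - u) \<le> p * (g \<bullet> D + w)"
    using vu p by (intro mult_left_mono) (auto simp: w_def)
  also have "p * (g \<bullet> D + w) \<le> p * (g \<bullet> D) + w"
    using mult_right_mono[OF p(2) \<open>w \<ge> 0\<close>] by (simp add: algebra_simps)
  finally have "\<Phi> m v \<le> \<Phi> m u + p * (g \<bullet> D)
      + ((\<alpha>1\<phi> + \<alpha>2\<phi> / m) * (M\<^sub>h * M\<^sub>c)\<^sup>2 + (M\<^sub>h * L\<^sub>c + (\<alpha>1h + \<alpha>2h / m) * M\<^sub>c\<^sup>2)) * e"
    by (simp add: w_def algebra_simps)
  also have "((\<alpha>1\<phi> + \<alpha>2\<phi> / m) * (M\<^sub>h * M\<^sub>c)\<^sup>2 + (M\<^sub>h * L\<^sub>c + (\<alpha>1h + \<alpha>2h / m) * M\<^sub>c\<^sup>2)) * e \<le> constraint_curvature m0 / m * e"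
  proof (rule mult_right_mono)
    have "(\<alpha>1\<phi> + \<alpha>2\<phi> / m) * (M\<^sub>h * M\<^sub>c)\<^sup>2 + (M\<^sub>h * L\<^sub>c + (\<alpha>1h + \<alpha>2h / m) * M\<^sub>c\<^sup>2) = constraint_curvature m / m"
      using m by (simp add: constraint_curvature_def field_simps)
    also have "\<dots> \<le> constraint_curvature m0 / m"
      unfolding constraint_curvature_def using m \<alpha> h(2) c(2)
      by (intro divide_right_mono add_mono mult_right_mono mult_left_mono) auto
    finally show "(\<alpha>1\<phi> + \<alpha>2\<phi> / m) * (M\<^sub>h * M\<^sub>c)\<^sup>2 + (M\<^sub>h * L\<^sub>c + (\<alpha>1h + \<alpha>2h / m) * M\<^sub>c\<^sup>2) \<le> constraint_curvature m0 / m" .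
  qed (simp add: e_def)
  finally show ?thesis
    using grad_g\<^sub>\<mu>[OF m(1), of x "z - x"] by (simp add: g\<^sub>\<mu>_def u_def v_def p_def g_def D_def e_def)
qed

lemma constraint_curvature_nonneg: "m0 \<ge> 0 \<Longrightarrow> constraint_curvature m0 \<ge> 0"
  using SA_h(1) SA_\<phi>(1) h(2) c(2) unfolding constraint_curvature_def
  by (auto simp: smoothing_approx_def intro!: add_nonneg_nonneg mult_nonneg_nonneg)

definition \<beta> :: real where
  "\<beta> = \<bar>\<alpha>31h\<bar> + \<bar>\<alpha>32h\<bar> + \<bar>\<alpha>31\<phi>\<bar> + \<bar>\<alpha>32\<phi>\<bar>"

lemma g\<^sub>\<mu>_close:
  assumes m: "m > 0"
  shows "\<bar>g\<^sub>\<mu> m z - pos_part (h (c z))\<bar> \<le> \<beta> * m"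
proof -
  have hb: "\<bar>h\<^sub>\<mu> m (c z) - h (c z)\<bar> \<le> (\<bar>\<alpha>31h\<bar> + \<bar>\<alpha>32h\<bar>) * m"
  proof -
    have "\<alpha>31h * m \<le> \<bar>\<alpha>31h\<bar> * m" "\<alpha>32h * m \<le> \<bar>\<alpha>32h\<bar> * m" "0 \<le> \<bar>\<alpha>31h\<bar> * m" "0 \<le> \<bar>\<alpha>32h\<bar> * m"
      using m by (auto intro: mult_right_mono)
    then show ?thesis
      using h\<^sub>\<mu>_smooth(4,5)[OF m, of "c z"] unfolding abs_le_iff by (simp add: algebra_simps)
  qed
  have "\<bar>\<Phi> m (h\<^sub>\<mu> m (c z)) - pos_part (h\<^sub>\<mu> m (c z))\<bar> \<le> (\<bar>\<alpha>31\<phi>\<bar> + \<bar>\<alpha>32\<phi>\<bar>) * m"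
  proof -
    have "\<alpha>31\<phi> * m \<le> \<bar>\<alpha>31\<phi>\<bar> * m" "\<alpha>32\<phi> * m \<le> \<bar>\<alpha>32\<phi>\<bar> * m" "0 \<le> \<bar>\<alpha>31\<phi>\<bar> * m" "0 \<le> \<bar>\<alpha>32\<phi>\<bar> * m"
      using m by (auto intro: mult_right_mono)
    then show ?thesis
      using \<Phi>_smooth(4,5)[OF m, of "h\<^sub>\<mu> m (c z)"] unfolding abs_le_iff by (simp add: algebra_simps)
  qed
  moreover have "\<bar>pos_part (h\<^sub>\<mu> m (c z)) - pos_part (h (c z))\<bar> \<le> \<bar>h\<^sub>\<mu> m (c z) - h (c z)\<bar>"
    by (simp add: pos_part_def max_def abs_if)
  moreover have "(\<bar>\<alpha>31h\<bar> + \<bar>\<alpha>32h\<bar>) * m + (\<bar>\<alpha>31\<phi>\<bar> + \<bar>\<alpha>32\<phi>\<bar>) * m = \<beta> * m"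
    by (simp add: \<beta>_def algebra_simps)
  ultimately show ?thesis using hb unfolding g\<^sub>\<mu>_def by linarith
qed

lemma \<beta>_nonneg: "\<beta> \<ge> 0"
  by (simp add: \<beta>_def)

text \<open>\<open>\<Phi>\<close> is monotone and nonexpansive, so it does not amplify the drift of the inner smoothing.\<close>

lemma g\<^sub>\<mu>_parameter_controlled: "parameter_controlled g\<^sub>\<mu> (\<alpha>4h + \<alpha>4\<phi>)"
  unfolding parameter_controlled_def
proof (intro conjI allI impI)
  have a: "\<alpha>4h \<ge> 0" "\<alpha>4\<phi> \<ge> 0" using SA_h(2) SA_\<phi>(2) by (auto simp: parameter_controlled_def)
  then show "0 \<le> \<alpha>4h + \<alpha>4\<phi>" by simp
  fix m0 m1 z assume m: "0 < m1 \<and> m1 \<le> (m0 :: real)"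
  have "g\<^sub>\<mu> m1 z \<le> \<Phi> m0 (h\<^sub>\<mu> m1 (c z)) + \<alpha>4\<phi> * (m0 - m1)"
    using SA_\<phi>(2) m by (auto simp: parameter_controlled_def g\<^sub>\<mu>_def)
  also have "\<Phi> m0 (h\<^sub>\<mu> m1 (c z)) \<le> \<Phi> m0 (h\<^sub>\<mu> m0 (c z) + \<alpha>4h * (m0 - m1))"
    using SA_h(2) m by (intro \<Phi>_mono) (auto simp: parameter_controlled_def)
  also have "\<dots> \<le> g\<^sub>\<mu> m0 z + \<alpha>4h * (m0 - m1)"
    unfolding g\<^sub>\<mu>_def using m a by (intro \<Phi>_nonexpansive) auto
  finally show "g\<^sub>\<mu> m1 z \<le> g\<^sub>\<mu> m0 z + (\<alpha>4h + \<alpha>4\<phi>) * (m0 - m1)" by (simp add: algebra_simps)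
qed

text \<open>Along \<open>d\<close> the function \<open>h\<close> does not increase at integer multiples of \<open>d\<close>, and by convexity not in
  between. So \<open>h\<^sub>\<mu>\<close> is bounded above on each ray in direction \<open>d\<close>, and a convex function bounded on a
  ray has nonpositive slope there: \<open>h\<close> and its smoothings share their recession directions.\<close>

lemma h\<^sub>\<mu>_hzn:
  assumes m: "m > 0" and d: "d \<in> hzn h"
  shows "h\<^sub>\<mu> m (y + d) \<le> h\<^sub>\<mu> m y"
proof -
  have "grad (h\<^sub>\<mu> m) (y + d) \<bullet> d \<le> 0"
  proof (rule linear_growth_bounds_slope[OF h\<^sub>\<mu>_smooth(1,2)[OF m]])
    fix s :: real assume s: "s > 0"
    define n where "n = nat \<lceil>s\<rceil>"
    have n: "real n \<ge> s" "n > 0" using s by (auto simp: n_def)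
    have "h (y' + real k *\<^sub>R d) \<le> h y'" for k y'
    proof (induction k)
      case (Suc k)
      have "h ((y' + real k *\<^sub>R d) + d) \<le> h (y' + real k *\<^sub>R d)" using d by (simp add: hzn_def)
      then show ?case using Suc by (simp add: algebra_simps)
    qed simp
    from this[of "y + d" n] have hn: "h (y + d + real n *\<^sub>R d) \<le> h (y + d)" .
    define t where "t = s / real n"
    have t: "0 \<le> t" "t \<le> 1" "s = t * real n" using n s by (auto simp: t_def)
    have "y + d + s *\<^sub>R d = (1 - t) *\<^sub>R (y + d) + t *\<^sub>R (y + d + real n *\<^sub>R d)"
      by (simp add: t(3) algebra_simps)
    then have "h (y + d + s *\<^sub>R d) \<le> (1 - t) * h (y + d) + t * h (y + d + real n *\<^sub>R d)"
      using convex_onD[OF h(1), of t] t by simp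
    also have "\<dots> \<le> h (y + d)" using mult_left_mono[OF hn t(1)] by (simp add: algebra_simps)
    finally show "h\<^sub>\<mu> m (y + d + s *\<^sub>R d) \<le> h\<^sub>\<mu> m (y + d) + s * 0 + (\<alpha>31h + \<alpha>32h) * m"
      using h\<^sub>\<mu>_smooth(5)[OF m, of "y + d + s *\<^sub>R d"] h\<^sub>\<mu>_smooth(4)[OF m, of "y + d"]
      by (simp add: algebra_simps)
  qed
  then show ?thesis
    using convex_above_tangent_plane[OF h\<^sub>\<mu>_smooth(1,2)[OF m], of "y + d" y] by simp
qed

lemma g\<^sub>\<mu>_convex:
  assumes m: "m > 0" and cc: "cone_convex (uminus ` hzn h) c"
  shows "convex_on UNIV (g\<^sub>\<mu> m)"
proof (rule convex_onI)
  fix t :: real and x z :: 'a assume t: "0 < t" "t < 1"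
  define v where "v = (1 - t) *\<^sub>R x + t *\<^sub>R z"
  have "(1 - t) *\<^sub>R c x + (1 - (1 - t)) *\<^sub>R c z - c ((1 - t) *\<^sub>R x + (1 - (1 - t)) *\<^sub>R z) \<in> uminus ` hzn h"
    using cc t unfolding cone_convex_def by (elim allE ballE[of _ _ "1 - t"]) auto
  then obtain d where d: "d \<in> hzn h" "(1 - t) *\<^sub>R c x + t *\<^sub>R c z - c v = - d"
    by (auto simp: v_def)
  then have "c v = ((1 - t) *\<^sub>R c x + t *\<^sub>R c z) + d" by (simp add: algebra_simps eq_neg_iff_add_eq_0)
  then have "h\<^sub>\<mu> m (c v) \<le> h\<^sub>\<mu> m ((1 - t) *\<^sub>R c x + t *\<^sub>R c z)" using h\<^sub>\<mu>_hzn[OF m d(1)] by simp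
  also have "\<dots> \<le> (1 - t) * h\<^sub>\<mu> m (c x) + t * h\<^sub>\<mu> m (c z)"
    using t by (intro convex_onD[OF h\<^sub>\<mu>_smooth(1)[OF m]]) auto
  finally have "g\<^sub>\<mu> m v \<le> \<Phi> m ((1 - t) *\<^sub>R h\<^sub>\<mu> m (c x) + t *\<^sub>R h\<^sub>\<mu> m (c z))"
    unfolding g\<^sub>\<mu>_def by (intro \<Phi>_mono[OF m]) simp
  also have "\<dots> \<le> (1 - t) * g\<^sub>\<mu> m x + t * g\<^sub>\<mu> m z"
    unfolding g\<^sub>\<mu>_def using t by (intro convex_onD[OF \<Phi>_smooth(1)[OF m]]) auto
  finally show "g\<^sub>\<mu> m ((1 - t) *\<^sub>R x + t *\<^sub>R z) \<le> (1 - t) * g\<^sub>\<mu> m x + t * g\<^sub>\<mu> m z" by (simp add: v_def)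
qed auto

end

section \<open>One step of the algorithm\<close>

text \<open>With \<open>P\<^sub>2 = 0\<close> this forces \<open>\<xi>\<^sub>k = 0\<close>. A nonzero Frechet subgradient \<open>w\<close> would make the difference
  quotient equal to \<open>-|w|\<close> along the ray in direction \<open>w\<close>.\<close>

lemma limiting_subdiff_const:
  fixes x :: "'a::euclidean_space"
  assumes "v \<in> limiting_subdiff (\<lambda>z. ereal a) x"
  shows "v = 0"
proof -
  have frechet: "w = 0" if "w \<in> frechet_subdiff (\<lambda>z. ereal a) y" for w y :: 'a
  proof (rule ccontr)
    assume "w \<noteq> 0"
    then have nw: "norm w > 0" by simp
    have "0 \<le> Liminf (at y) (\<lambda>z. (ereal a - ereal a - ereal (w \<bullet> (z - y))) / ereal (norm (z - y)))"
      using that by (simp add: frechet_subdiff_def)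
    then have "eventually (\<lambda>z. ereal (- norm w) < (ereal a - ereal a - ereal (w \<bullet> (z - y))) / ereal (norm (z - y))) (at y)"
      unfolding le_Liminf_iff using nw by simp
    then obtain d where d: "d > 0" and *: "\<And>z. z \<noteq> y \<Longrightarrow> dist z y < d \<Longrightarrow>
        ereal (- norm w) < (ereal a - ereal a - ereal (w \<bullet> (z - y))) / ereal (norm (z - y))"
      unfolding eventually_at by auto
    define s where "s = d / (2 * norm w)"
    have s: "s > 0" "s * norm w < d" using d nw by (auto simp: s_def)
    have "ereal (- norm w) < (ereal a - ereal a - ereal (w \<bullet> (s *\<^sub>R w))) / ereal (norm (s *\<^sub>R w))"
      using *[of "y + s *\<^sub>R w"] s nw by (simp add: dist_norm)
    then have "- norm w < - (w \<bullet> (s *\<^sub>R w)) / norm (s *\<^sub>R w)"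
      using s nw by (simp flip: zero_ereal_def)
    also have "\<dots> = - norm w"
      using s nw by (simp add: power2_norm_eq_inner[symmetric] power2_eq_square)
    finally show False by simp
  qed
  obtain V where "V \<longlonglongrightarrow> v" "\<And>n. \<exists>y. V n \<in> frechet_subdiff (\<lambda>z. ereal a) y"
    using assms by (auto simp: limiting_subdiff_def)
  then have "V = (\<lambda>n. 0)" using frechet by blast
  with \<open>V \<longlonglongrightarrow> v\<close> show ?thesis using LIMSEQ_unique tendsto_const by blast
qed

text \<open>Passing to real values: off \<open>C\<close> the objective is infinite, and the constant
  \<open>F y - grad F y \<bullet> y\<close> of the linearization can be dropped.\<close>

lemma trial_point_iff:
  assumes "C \<noteq> {}"
  shows "trial_point f P1 C F \<gamma> m 0 y l z \<longleftrightarrow>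
     z \<in> C \<and> (\<forall>w\<in>C. (\<gamma> * (grad f y \<bullet> z + P1 z) + grad F y \<bullet> z) + l / (2 * m) * (norm (z - y))\<^sup>2
       \<le> (\<gamma> * (grad f y \<bullet> w + P1 w) + grad F y \<bullet> w) + l / (2 * m) * (norm (w - y))\<^sup>2)"
    (is "?L \<longleftrightarrow> z \<in> C \<and> (\<forall>w\<in>C. ?q z \<le> ?q w)")
proof -
  define S where "S = subproblem_objective f P1 C F \<gamma> m 0 y l"
  have S: "S w = (if w \<in> C then ereal (?q w + (F y - grad F y \<bullet> y)) else \<infinity>)" for w
    by (simp add: S_def subproblem_objective_def indicator_ext_def algebra_simps)
  have "?L \<longleftrightarrow> (\<forall>w. \<not> S w < S z)" by (simp add: trial_point_def is_arg_min_def S_def)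
  also have "\<dots> \<longleftrightarrow> z \<in> C \<and> (\<forall>w\<in>C. ?q z \<le> ?q w)"
    using assms by (auto simp: S not_less split: if_splits)
  finally show ?thesis .
qed

text \<open>A run of the algorithm in the convex case, with \<open>P\<^sub>2\<close> replaced by \<open>0\<close>.\<close>

locale sESQM_run = smoothed_composite C c h h\<^sub>\<mu> \<Phi> L\<^sub>c M\<^sub>c M\<^sub>h \<alpha>1h \<alpha>2h \<alpha>31h \<alpha>32h \<alpha>4h \<alpha>1\<phi> \<alpha>2\<phi> \<alpha>31\<phi> \<alpha>32\<phi> \<alpha>4\<phi>
  for C :: "'a::euclidean_space set"
    and c :: "'a \<Rightarrow> 'b::euclidean_space"
    and h h\<^sub>\<mu> \<Phi> L\<^sub>c M\<^sub>c M\<^sub>h \<alpha>1h \<alpha>2h \<alpha>31h \<alpha>32h \<alpha>4h \<alpha>1\<phi> \<alpha>2\<phi> \<alpha>31\<phi> \<alpha>32\<phi> \<alpha>4\<phi> +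
  fixes f P1 :: "'a \<Rightarrow> real"
    and L\<^sub>f Llow Lup c1 c2 :: real
    and x \<xi> :: "nat \<Rightarrow> 'a"
    and L0 L \<mu> \<gamma> \<gamma>hat :: "nat \<Rightarrow> real"
    and t :: "nat \<Rightarrow> nat"
  assumes f: "C1_fun f" "L\<^sub>f > 0" "smooth_on_set L\<^sub>f C f" "convex_on UNIV f"
    and P1: "convex_on UNIV P1"
    and alg: "sESQM f P1 (\<lambda>_. 0) C c h\<^sub>\<mu> \<Phi> (\<alpha>31\<phi> + \<alpha>32\<phi>) Llow Lup c1 c2 \<gamma>hat x \<xi> L0 L \<mu> t \<gamma>"
    and cc: "cone_convex (uminus ` hzn h) c"
begin

lemma constants: "0 < Llow" "Llow \<le> Lup" "0 < c1" "0 < c2"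
  using alg by (auto simp: sESQM_def)

lemma \<gamma>hat_pos: "0 < \<gamma>hat n"
  using alg unfolding sESQM_def by (metis less_trans)

lemma \<gamma>hat_decreasing: "decseq \<gamma>hat"
  using alg by (auto simp: sESQM_def decseq_Suc_iff less_imp_le)

lemma \<gamma>_eq: "\<gamma> k = \<gamma>hat (t k)"
  using alg by (auto simp: sESQM_def Let_def)

lemma \<gamma>_bounds: "0 < \<gamma> k" "\<gamma> k \<le> \<gamma>hat 0"
  using \<gamma>hat_pos decseqD[OF \<gamma>hat_decreasing, of 0 "t k"] by (auto simp: \<gamma>_eq)

lemma \<mu>_pos: "0 < \<mu> k"
  using alg by (cases k) (auto simp: sESQM_def Let_def)

lemma \<mu>_decreasing: "decseq \<mu>"
  using alg by (auto simp: sESQM_def Let_def decseq_Suc_iff)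

lemma \<mu>_le_initial: "\<mu> k \<le> \<mu> 0"
  using decseqD[OF \<mu>_decreasing, of 0 k] by simp

lemma t_Suc:
  "t (Suc k) = (if h\<^sub>\<mu> (\<mu> k) (c (x (Suc k))) > 2 * (\<alpha>31\<phi> + \<alpha>32\<phi>) * \<mu> k \<and>
     norm (x (Suc k) - x k) \<le> c2 * \<mu> k * \<gamma> k then t k + 1 else t k)"
  using alg unfolding sESQM_def Let_def by blast

lemma t_mono: "mono t"
  unfolding mono_iff_le_Suc by (simp add: t_Suc)

lemma \<xi>_zero: "\<xi> k = 0"
proof -
  have "\<xi> k \<in> limiting_subdiff (\<lambda>z. ereal 0) (x k)"
    using alg unfolding sESQM_def Let_def by blast
  then show ?thesis by (rule limiting_subdiff_const)
qed

lemma g\<^sub>\<mu>_fold: "(\<lambda>z. \<Phi> m (h\<^sub>\<mu> m (c z))) = g\<^sub>\<mu> m"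
  by (simp add: g\<^sub>\<mu>_def[abs_def])

lemma C_nonempty: "C \<noteq> {}"
  using alg by (auto simp: sESQM_def)

text \<open>The objective of the subproblem without its proximal term.\<close>

definition model :: "nat \<Rightarrow> 'a \<Rightarrow> real" where
  "model k z = \<gamma> k * (grad f (x k) \<bullet> z + P1 z) + grad (g\<^sub>\<mu> (\<mu> k)) (x k) \<bullet> z"

definition merit :: "nat \<Rightarrow> 'a \<Rightarrow> real" where
  "merit k z = \<gamma> k * (f z + P1 z) + g\<^sub>\<mu> (\<mu> k) z"

text \<open>Divided by \<open>\<mu> k\<close>, this bounds the curvature of the smooth part of \<open>merit k\<close> uniformly in \<open>k\<close>.\<close>

definition model_curvature :: real where
  "model_curvature = \<gamma>hat 0 * L\<^sub>f * \<mu> 0 + constraint_curvature (\<mu> 0)"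

text \<open>A trial constant of at least \<open>c1 + 2 * model_curvature\<close> passes the descent test, so doubling a
  rejected one stays below twice this threshold.\<close>

definition Lmax :: real where
  "Lmax = max Lup (2 * (c1 + 2 * model_curvature))"

lemma model_curvature_nonneg: "model_curvature \<ge> 0"
  unfolding model_curvature_def using \<gamma>hat_pos f(2) \<mu>_pos[of 0] constraint_curvature_nonneg[of "\<mu> 0"]
  by (intro add_nonneg_nonneg mult_nonneg_nonneg) (auto simp: less_imp_le)

lemma Lmax_pos: "Lmax > 0"
  using constants by (simp add: Lmax_def less_max_iff_disj)

lemma trial_iff:
  "trial_point f P1 C (g\<^sub>\<mu> (\<mu> k)) (\<gamma> k) (\<mu> k) (\<xi> k) (x k) l z \<longleftrightarrow>
     z \<in> C \<and> (\<forall>w\<in>C. model k z + l / (2 * \<mu> k) * (norm (z - x k))\<^sup>2 \<le> model k w + l / (2 * \<mu> k) * (norm (w - x k))\<^sup>2)"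
  using trial_point_iff[OF C_nonempty] by (simp add: \<xi>_zero model_def)

lemma accepted_trial:
  "trial_point f P1 C (g\<^sub>\<mu> (\<mu> k)) (\<gamma> k) (\<mu> k) (\<xi> k) (x k) (L k) (x (Suc k))"
  using alg unfolding sESQM_def Let_def g\<^sub>\<mu>_fold by blast

lemma x_in_C: "x k \<in> C"
proof (cases k)
  case 0
  then show ?thesis using alg by (auto simp: sESQM_def)
next
  case (Suc n)
  then show ?thesis using accepted_trial[of n] by (simp add: trial_iff)
qed

lemma descent_iff:
  assumes "z \<in> C"
  shows "sufficient_descent (psi f P1 (\<lambda>_. 0) C) (g\<^sub>\<mu> (\<mu> k)) (\<gamma> k) (\<mu> k) c1 (x k) z \<longleftrightarrow>
     merit k z \<le> merit k (x k) - c1 / (2 * \<mu> k) * (norm (z - x k))\<^sup>2"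
  using assms x_in_C[of k]
  by (simp add: sufficient_descent_def psi_def indicator_ext_def merit_def)

lemma descent:
  "merit k (x (Suc k)) \<le> merit k (x k) - c1 / (2 * \<mu> k) * (norm (x (Suc k) - x k))\<^sup>2"
proof -
  have "sufficient_descent (psi f P1 (\<lambda>_. 0) C) (g\<^sub>\<mu> (\<mu> k)) (\<gamma> k) (\<mu> k) c1 (x k) (x (Suc k))"
    using alg unfolding sESQM_def Let_def g\<^sub>\<mu>_fold by blast
  then show ?thesis using descent_iff[OF x_in_C] by blast
qed

lemma continuous_P1: "continuous_on S P1"
  using convex_on_continuous[OF open_UNIV P1] continuous_on_subset by blast

lemma continuous_f: "continuous_on S f"
  using f(1) by (rule continuous_C1)

text \<open>The model replaces \<open>f\<close> and \<open>g\<^sub>\<mu>\<close> by their tangents; the two curvature errors combine into a multiple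
  of \<open>1 / \<mu> k\<close> because \<open>\<mu>\<close> and \<open>\<gamma>\<close> are bounded by their initial values.\<close>

lemma merit_le_model:
  assumes z: "z \<in> C"
  shows "merit k z \<le> merit k (x k) + (model k z - model k (x k)) + model_curvature / \<mu> k * (norm (z - x k))\<^sup>2"
proof -
  define e where "e = (norm (z - x k))\<^sup>2"
  have "norm (f z - f (x k) - total_deriv f (x k) (z - x k)) \<le> L\<^sub>f * e"
    unfolding e_def using smooth_on_set_linearization_error[OF f(1,3) C(2) x_in_C z] .
  then have "f z \<le> f (x k) + grad f (x k) \<bullet> (z - x k) + L\<^sub>f * e"
    by (simp add: C1_fun_grad_total_deriv[OF f(1)] abs_le_iff)
  then have 1: "\<gamma> k * f z \<le> \<gamma> k * (f (x k) + grad f (x k) \<bullet> (z - x k) + L\<^sub>f * e)"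
    using \<gamma>_bounds(1)[of k] by (intro mult_left_mono) auto
  have "g\<^sub>\<mu> (\<mu> k) z \<le> g\<^sub>\<mu> (\<mu> k) (x k) + grad (g\<^sub>\<mu> (\<mu> k)) (x k) \<bullet> (z - x k) + constraint_curvature (\<mu> 0) / \<mu> k * e"
    unfolding e_def by (rule g\<^sub>\<mu>_quadratic_upper_bound[OF \<mu>_pos \<mu>_le_initial x_in_C z])
  moreover have "\<gamma> k * L\<^sub>f * e + constraint_curvature (\<mu> 0) / \<mu> k * e \<le> model_curvature / \<mu> k * e"
  proof -
    have "\<gamma> k * L\<^sub>f * \<mu> k \<le> \<gamma>hat 0 * L\<^sub>f * \<mu> 0"
      using \<gamma>_bounds[of k] f(2) \<mu>_pos[of k] \<mu>_le_initial[of k] \<gamma>hat_pos[of 0]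
      by (intro mult_mono) auto
    then have "\<gamma> k * L\<^sub>f \<le> \<gamma>hat 0 * L\<^sub>f * \<mu> 0 / \<mu> k"
      using \<mu>_pos[of k] by (simp add: field_simps)
    then have "\<gamma> k * L\<^sub>f + constraint_curvature (\<mu> 0) / \<mu> k \<le> model_curvature / \<mu> k" by (simp add: model_curvature_def add_divide_distrib)
    then have "(\<gamma> k * L\<^sub>f + constraint_curvature (\<mu> 0) / \<mu> k) * e \<le> model_curvature / \<mu> k * e"
      by (rule mult_right_mono) (simp add: e_def)
    then show ?thesis by (simp add: algebra_simps)
  qed
  ultimately show ?thesis using 1
    unfolding merit_def model_def e_def[symmetric] by (simp add: algebra_simps)
qed

lemma merit_ge_model:
  "merit k (x k) + (model k z - model k (x k)) \<le> merit k z"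
proof -
  have "\<gamma> k * (f (x k) + grad f (x k) \<bullet> (z - x k)) \<le> \<gamma> k * f z"
    using convex_above_tangent_plane[OF f(4,1)] \<gamma>_bounds(1)[of k] by (intro mult_left_mono) auto
  moreover have "g\<^sub>\<mu> (\<mu> k) (x k) + grad (g\<^sub>\<mu> (\<mu> k)) (x k) \<bullet> (z - x k) \<le> g\<^sub>\<mu> (\<mu> k) z"
    unfolding grad_g\<^sub>\<mu>[OF \<mu>_pos]
    by (rule convex_above_derivative[OF g\<^sub>\<mu>_convex[OF \<mu>_pos cc] g\<^sub>\<mu>_has_derivative[OF \<mu>_pos]])
  ultimately show ?thesis unfolding merit_def model_def by (simp add: algebra_simps)
qed

lemma model_convex: "convex_on C (model k)"
proof -
  have lin: "convex_on C (\<lambda>z. a \<bullet> z)" for a :: 'a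
    using C(2) by (intro convex_onI) (auto simp: inner_add_right)
  have "convex_on C (\<lambda>z. \<gamma> k * (grad f (x k) \<bullet> z + P1 z))"
    using \<gamma>_bounds(1)[of k] convex_on_subset[OF P1, of C] C(2) lin
    by (intro convex_on_cmul convex_on_add) auto
  then show ?thesis unfolding model_def[abs_def] by (intro convex_on_add lin)
qed

text \<open>If a constant was rejected, the last one is half of \<open>L k\<close> and it is small: by compactness its subproblem has a solution,
  which would have passed the descent test if the constant were at least
  \<open>c1 + 2 * model_curvature\<close>.\<close>

lemma L_bounds: "Llow \<le> L k" "L k \<le> Lmax"
proof -
  have L0: "Llow \<le> L0 k" "L0 k \<le> Lup" using alg by (auto simp: sESQM_def Let_def)
  obtain i where i: "L k = 2 ^ i * L0 k"
    and fail: "\<And>j z. j < i \<Longrightarrow> trial_point f P1 C (g\<^sub>\<mu> (\<mu> k)) (\<gamma> k) (\<mu> k) (\<xi> k) (x k) (2 ^ j * L0 k) z \<Longrightarrow>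
       \<not> sufficient_descent (psi f P1 (\<lambda>_. 0) C) (g\<^sub>\<mu> (\<mu> k)) (\<gamma> k) (\<mu> k) c1 (x k) z"
    using alg unfolding sESQM_def Let_def g\<^sub>\<mu>_fold by blast
  have "1 * L0 k \<le> 2 ^ i * L0 k" using L0 constants(1) by (intro mult_right_mono) auto
  then show "Llow \<le> L k" using L0 i by simp
  show "L k \<le> Lmax"
  proof (cases i)
    case 0
    then show ?thesis using i L0 by (simp add: Lmax_def)
  next
    case (Suc j)
    define l where "l = 2 ^ j * L0 k"
    have "l < c1 + 2 * model_curvature"
    proof (rule ccontr)
      assume "\<not> l < c1 + 2 * model_curvature"
      then have l: "c1 + 2 * model_curvature \<le> l" by simp
      have "continuous_on C (\<lambda>z. model k z + l / (2 * \<mu> k) * (norm (z - x k))\<^sup>2)"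
        unfolding model_def by (intro continuous_intros continuous_P1)
      then obtain z where z: "z \<in> C" "\<forall>w\<in>C. model k z + l / (2 * \<mu> k) * (norm (z - x k))\<^sup>2 \<le> model k w + l / (2 * \<mu> k) * (norm (w - x k))\<^sup>2"
        using continuous_attains_inf[OF C(1) C_nonempty] by blast
      then have "\<not> sufficient_descent (psi f P1 (\<lambda>_. 0) C) (g\<^sub>\<mu> (\<mu> k)) (\<gamma> k) (\<mu> k) c1 (x k) z"
        by (intro fail[of j]) (auto simp: trial_iff Suc l_def)
      moreover have "merit k z \<le> merit k (x k) - c1 / (2 * \<mu> k) * (norm (z - x k))\<^sup>2"
      proof -
        have "model k z + l / (2 * \<mu> k) * (norm (z - x k))\<^sup>2 \<le> model k (x k)"
          using z(2) x_in_C[of k] by force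
        moreover have "(c1 + 2 * model_curvature) / (2 * \<mu> k) * (norm (z - x k))\<^sup>2 \<le> l / (2 * \<mu> k) * (norm (z - x k))\<^sup>2"
          using l \<mu>_pos[of k] by (intro mult_right_mono divide_right_mono) auto
        moreover have "(c1 + 2 * model_curvature) / (2 * \<mu> k) * (norm (z - x k))\<^sup>2
            = c1 / (2 * \<mu> k) * (norm (z - x k))\<^sup>2 + model_curvature / \<mu> k * (norm (z - x k))\<^sup>2"
          using \<mu>_pos[of k] by (simp add: field_simps)
        ultimately show ?thesis using merit_le_model[OF z(1), of k] by linarith
      qed
      ultimately show False using descent_iff[OF z(1)] by blast
    qed
    then show ?thesis using i Suc by (simp add: Lmax_def l_def)
  qed
qed

lemma three_point:
  assumes z: "z \<in> C"
  shows "model k (x (Suc k)) + L k / (2 * \<mu> k) * (norm (x (Suc k) - x k))\<^sup>2 + L k / (2 * \<mu> k) * (norm (z - x (Suc k)))\<^sup>2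
     \<le> model k z + L k / (2 * \<mu> k) * (norm (z - x k))\<^sup>2"
  using accepted_trial[of k] z by (intro strongly_convex_minimizer[OF model_convex]) (auto simp: trial_iff)

text \<open>Since the accepted constant may lie below the curvature of the model, a term proportional to the
  squared step length remains; it is charged to the decrease of the merit function that the descent
  test guarantees.\<close>

lemma fundamental_inequality:
  assumes z: "z \<in> C"
  shows "merit k (x (Suc k)) \<le> merit k z + L k / (2 * \<mu> k) * ((norm (z - x k))\<^sup>2 - (norm (z - x (Suc k)))\<^sup>2)
     + 2 * model_curvature / c1 * (merit k (x k) - merit k (x (Suc k)))"
proof -
  define e where "e = (norm (x (Suc k) - x k))\<^sup>2"
  have "0 \<le> L k / (2 * \<mu> k) * e"
    using L_bounds(1)[of k] constants(1) \<mu>_pos[of k] by (simp add: e_def)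
  moreover have "model_curvature / \<mu> k * e \<le> 2 * model_curvature / c1 * (merit k (x k) - merit k (x (Suc k)))"
  proof -
    have "2 * model_curvature / c1 * (c1 / (2 * \<mu> k) * e) \<le> 2 * model_curvature / c1 * (merit k (x k) - merit k (x (Suc k)))"
      using descent[of k] model_curvature_nonneg constants(3) by (intro mult_left_mono) (auto simp: e_def)
    then show ?thesis using constants(3) \<mu>_pos[of k] by (simp add: field_simps)
  qed
  ultimately show ?thesis
    using three_point[OF z, of k] merit_le_model[OF x_in_C, of k "Suc k"] merit_ge_model[of k z]
    unfolding e_def right_diff_distrib by linarith
qed

end

section \<open>The penalty parameter changes only finitely often\<close>

lemma frechet_subdiff_subset_limiting: "frechet_subdiff F z \<subseteq> limiting_subdiff F z"
proof
  fix v assume v: "v \<in> frechet_subdiff F z"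
  then have "\<bar>F z\<bar> \<noteq> \<infinity>" by (simp add: frechet_subdiff_def)
  moreover have "(\<lambda>n::nat. z) \<longlonglongrightarrow> z \<and> (\<lambda>n::nat. F z) \<longlonglongrightarrow> F z \<and> (\<forall>n::nat. v \<in> frechet_subdiff F z) \<and> (\<lambda>n::nat. v) \<longlonglongrightarrow> v"
    using v by simp
  ultimately show "v \<in> limiting_subdiff F z"
    unfolding limiting_subdiff_def mem_Collect_eq
    by (intro conjI exI[of _ "\<lambda>n::nat. z"] exI[of _ "\<lambda>n::nat. v"]) auto
qed

lemma variational_inequality_normal_cone:
  assumes z: "z \<in> C" and v: "\<And>y. y \<in> C \<Longrightarrow> v \<bullet> (y - z) \<le> 0"
  shows "v \<in> normal_cone C z"
proof -
  have "0 \<le> Liminf (at z) (\<lambda>y. (indicator_ext C y - indicator_ext C z - ereal (v \<bullet> (y - z))) / ereal (norm (y - z)))"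
  proof (rule Liminf_bounded)
    have "0 \<le> (indicator_ext C y - indicator_ext C z - ereal (v \<bullet> (y - z))) / ereal (norm (y - z))" if "y \<noteq> z" for y
      using that v[of y] z by (cases "y \<in> C") (auto simp: indicator_ext_def divide_nonpos_nonneg simp flip: zero_ereal_def)
    then show "eventually (\<lambda>y. 0 \<le> (indicator_ext C y - indicator_ext C z - ereal (v \<bullet> (y - z))) / ereal (norm (y - z))) (at z)"
      by (simp add: eventually_at_filter)
  qed
  then have "v \<in> frechet_subdiff (indicator_ext C) z"
    using z by (simp add: frechet_subdiff_def indicator_ext_def)
  then show ?thesis using frechet_subdiff_subset_limiting by (auto simp: normal_cone_def)
qed

text \<open>The subgradient inequality at \<open>c y\<close> holds exactly; replacing \<open>c y - c z\<close> by its linearization costs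
  \<open>o(|y - z|)\<close>, so \<open>adjoint D v\<close> is even a Frechet subgradient.\<close>

lemma subgradient_chain_rule:
  fixes c :: "'a::euclidean_space \<Rightarrow> 'b::euclidean_space"
  assumes v: "\<And>y. h (c z) + v \<bullet> (y - c z) \<le> h y"
    and deriv: "(c has_derivative D) (at z)"
  shows "adjoint D v \<in> limiting_subdiff (\<lambda>y. ereal (h (c y))) z"
proof -
  define q where "q y = norm (c y - c z - D (y - z)) / norm (y - z)" for y
  have "(q \<longlongrightarrow> 0) (at z)" using deriv unfolding has_derivative_iff_norm q_def by blast
  then have "((\<lambda>y. - (norm v * q y)) \<longlongrightarrow> - (norm v * 0)) (at z)" by (intro tendsto_intros)
  then have "((\<lambda>y. ereal (- (norm v * q y))) \<longlongrightarrow> 0) (at z)" unfolding zero_ereal_def by (intro tendsto_ereal) simp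
  then have "0 = Liminf (at z) (\<lambda>y. ereal (- (norm v * q y)))"
    by (intro lim_imp_Liminf[symmetric]) auto
  also have "\<dots> \<le> Liminf (at z) (\<lambda>y. (ereal (h (c y)) - ereal (h (c z)) - ereal (adjoint D v \<bullet> (y - z))) / ereal (norm (y - z)))"
  proof (rule Liminf_mono)
    have "- (norm v * q y) \<le> (h (c y) - h (c z) - adjoint D v \<bullet> (y - z)) / norm (y - z)" if "y \<noteq> z" for y
    proof -
      have "- (norm v * norm (c y - c z - D (y - z))) \<le> v \<bullet> (c y - c z - D (y - z))"
        using Cauchy_Schwarz_ineq2[of v "c y - c z - D (y - z)"] by (simp add: abs_le_iff)
      also have "\<dots> = v \<bullet> (c y - c z) - adjoint D v \<bullet> (y - z)"
        using adjoint_works[OF has_derivative_linear[OF deriv], of "y - z" v]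
        by (simp add: inner_diff_right inner_commute)
      also have "\<dots> \<le> h (c y) - h (c z) - adjoint D v \<bullet> (y - z)" using v[of "c y"] by simp
      finally show ?thesis using that by (simp add: q_def field_simps)
    qed
    then show "eventually (\<lambda>y. ereal (- (norm v * q y)) \<le> (ereal (h (c y)) - ereal (h (c z)) - ereal (adjoint D v \<bullet> (y - z))) / ereal (norm (y - z))) (at z)"
      by (simp add: eventually_at_filter)
  qed
  finally have "adjoint D v \<in> frechet_subdiff (\<lambda>y. ereal (h (c y))) z"
    by (simp add: frechet_subdiff_def)
  then show ?thesis using frechet_subdiff_subset_limiting by blast
qed

context sESQM_run
begin

lemma increment_iff:
  "t (Suc k) = t k + 1 \<longleftrightarrow> h\<^sub>\<mu> (\<mu> k) (c (x (Suc k))) > 2 * (\<alpha>31\<phi> + \<alpha>32\<phi>) * \<mu> k \<and>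
     norm (x (Suc k) - x k) \<le> c2 * \<mu> k * \<gamma> k"
  by (simp add: t_Suc)

text \<open>Strong convexity of the subproblem yields its optimality condition in variational form. At an
  increment the proximal force \<open>(L/\<mu>) |x\<^sub>k\<^sub>+\<^sub>1 - x\<^sub>k|\<close> is at most \<open>L c\<^sub>2 \<gamma>\<^sub>k\<close>, so everything besides the
  gradient of the constraint is \<open>O(\<gamma>\<^sub>k)\<close> uniformly on the compact set \<open>C\<close>.\<close>

lemma increment_variational_inequality:
  "\<exists>K\<ge>0. \<forall>k. \<forall>z\<in>C. t (Suc k) = t k + 1 \<longrightarrow> - (K * \<gamma> k) \<le> grad (g\<^sub>\<mu> (\<mu> k)) (x k) \<bullet> (z - x (Suc k))"
proof -
  obtain B where B: "\<And>y z. y \<in> C \<Longrightarrow> z \<in> C \<Longrightarrow> norm (y - z) \<le> B" and B0: "B \<ge> 0"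
  proof -
    have bd: "dist y z \<le> diameter C" if "y \<in> C" "z \<in> C" for y z
      using diameter_bounded_bound[OF compact_imp_bounded[OF C(1)]] that by blast
    show ?thesis
    proof
      show "\<And>y z. y \<in> C \<Longrightarrow> z \<in> C \<Longrightarrow> norm (y - z) \<le> diameter C" using bd by (simp add: dist_norm)
      show "diameter C \<ge> 0" using compact_imp_bounded[OF C(1)] by (rule diameter_ge_0)
    qed
  qed
  obtain B1 where B1: "\<And>y. y \<in> C \<Longrightarrow> \<bar>P1 y\<bar> \<le> B1"
    using compact_imp_bounded[OF compact_continuous_image[OF continuous_P1 C(1)]]
    by (auto simp: bounded_iff)
  obtain B2 where B2: "\<And>y. y \<in> C \<Longrightarrow> norm (total_deriv f y) \<le> B2"
  proof -
    have "continuous_on C (total_deriv f)" using f(1) continuous_on_subset by (auto simp: C1_fun_def)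
    then show ?thesis using compact_imp_bounded[OF compact_continuous_image[OF _ C(1)]] that
      by (force simp: bounded_iff)
  qed
  have B12: "B1 \<ge> 0" "B2 \<ge> 0" using B1[OF x_in_C[of 0]] B2[OF x_in_C[of 0]] norm_ge_zero order_trans
    by (force, blast)
  define K where "K = B2 * B + 2 * B1 + Lmax * c2 * B"
  show ?thesis
  proof (intro exI[of _ K] conjI allI ballI impI)
    show "K \<ge> 0" unfolding K_def using B0 B12 Lmax_pos constants
      by (intro add_nonneg_nonneg mult_nonneg_nonneg) auto
    fix k z assume z: "z \<in> C" and "t (Suc k) = t k + 1"
    then have step: "norm (x (Suc k) - x k) \<le> c2 * \<mu> k * \<gamma> k" unfolding increment_iff by blast
    define w l where "w = x (Suc k)" and "l = L k / (2 * \<mu> k)"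
    have l: "l \<ge> 0" using L_bounds(1)[of k] constants(1) \<mu>_pos[of k] by (simp add: l_def)
    have expand: "(norm (z - x k))\<^sup>2 - (norm (z - w))\<^sup>2 - (norm (w - x k))\<^sup>2 = 2 * ((z - w) \<bullet> (w - x k))"
      by (simp add: power2_norm_eq_inner algebra_simps inner_commute)
    have "model k w - model k z \<le> l * ((norm (z - x k))\<^sup>2 - (norm (z - w))\<^sup>2 - (norm (w - x k))\<^sup>2)"
      using three_point[OF z, of k] by (simp add: w_def l_def algebra_simps)
    also have "\<dots> = l * (2 * ((z - w) \<bullet> (w - x k)))" by (simp only: expand)
    also have "\<dots> \<le> l * (2 * (B * (c2 * \<mu> k * \<gamma> k)))"
    proof -
      have "(z - w) \<bullet> (w - x k) \<le> norm (z - w) * norm (w - x k)" by (rule norm_cauchy_schwarz)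
      also have "\<dots> \<le> B * (c2 * \<mu> k * \<gamma> k)"
        using B[OF z x_in_C] step B0 by (intro mult_mono) (auto simp: w_def)
      finally show ?thesis using l by (intro mult_left_mono) auto
    qed
    also have "\<dots> = L k * (c2 * B * \<gamma> k)" using \<mu>_pos[of k] by (simp add: l_def field_simps)
    also have "\<dots> \<le> Lmax * (c2 * B * \<gamma> k)"
      using L_bounds(2) constants \<gamma>_bounds(1)[of k] B0 by (intro mult_right_mono mult_nonneg_nonneg) auto
    finally have 1: "model k w - model k z \<le> Lmax * c2 * B * \<gamma> k" by (simp add: mult_ac)
    have "grad f (x k) \<bullet> (z - w) \<le> norm (total_deriv f (x k)) * norm (z - w)"
      using norm_blinfun[of "total_deriv f (x k)" "z - w"] by (simp add: C1_fun_grad_total_deriv[OF f(1)] abs_le_iff)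
    also have "\<dots> \<le> B2 * B"
      using B2[OF x_in_C] B[OF z x_in_C] B12 unfolding w_def by (intro mult_mono) auto
    finally have "grad f (x k) \<bullet> (z - w) + (P1 z - P1 w) \<le> B2 * B + 2 * B1"
      using B1[OF z] B1[OF x_in_C[of "Suc k"]] unfolding w_def by (simp add: abs_le_iff)
    then have "\<gamma> k * (grad f (x k) \<bullet> (z - w) + (P1 z - P1 w)) \<le> \<gamma> k * (B2 * B + 2 * B1)"
      using \<gamma>_bounds(1)[of k] by (intro mult_left_mono) auto
    moreover have "model k z - model k w = \<gamma> k * (grad f (x k) \<bullet> (z - w) + (P1 z - P1 w)) + grad (g\<^sub>\<mu> (\<mu> k)) (x k) \<bullet> (z - w)"
      by (simp add: model_def algebra_simps)
    ultimately show "- (K * \<gamma> k) \<le> grad (g\<^sub>\<mu> (\<mu> k)) (x k) \<bullet> (z - x (Suc k))"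
      using 1 unfolding w_def[symmetric] K_def by (simp add: algebra_simps)
  qed
qed

text \<open>The test inspects the new point, but the slope enters at the old one. The short step changes
  \<open>h\<^sub>\<mu> \<circ> c\<close> by at most \<open>\<alpha>\<^sub>3 \<mu> / 2\<close> once \<open>\<gamma>\<close> is small, which leaves a violation of \<open>3/2 \<alpha>\<^sub>3 \<mu>\<close>.\<close>

lemma increment_slope:
  assumes "t (Suc k) = t k + 1" and "M\<^sub>h * M\<^sub>c * c2 * \<gamma> k \<le> (\<alpha>31\<phi> + \<alpha>32\<phi>) / 2"
  shows "1/3 \<le> grad (\<Phi> (\<mu> k)) (h\<^sub>\<mu> (\<mu> k) (c (x k)))"
proof (rule grad_\<Phi>_lower[OF \<mu>_pos])
  have inc: "h\<^sub>\<mu> (\<mu> k) (c (x (Suc k))) > 2 * (\<alpha>31\<phi> + \<alpha>32\<phi>) * \<mu> k"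
    "norm (x (Suc k) - x k) \<le> c2 * \<mu> k * \<gamma> k"
    using assms(1) unfolding increment_iff by blast+
  have "h\<^sub>\<mu> (\<mu> k) (c (x (Suc k))) - h\<^sub>\<mu> (\<mu> k) (c (x k)) \<le> M\<^sub>h * norm (c (x (Suc k)) - c (x k))"
    by (rule h\<^sub>\<mu>_lip[OF \<mu>_pos])
  also have "\<dots> \<le> M\<^sub>h * (M\<^sub>c * (c2 * \<mu> k * \<gamma> k))"
    using c_lip[OF x_in_C x_in_C, of "Suc k" k] inc(2) h(2) c(4)
    by (intro mult_left_mono) (auto intro: order_trans mult_left_mono)
  also have "\<dots> = (M\<^sub>h * M\<^sub>c * c2 * \<gamma> k) * \<mu> k" by simp
  also have "\<dots> \<le> (\<alpha>31\<phi> + \<alpha>32\<phi>) / 2 * \<mu> k"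
    using assms(2) \<mu>_pos[of k] by (intro mult_right_mono) auto
  finally show "3/2 * ((\<alpha>31\<phi> + \<alpha>32\<phi>) * \<mu> k) \<le> h\<^sub>\<mu> (\<mu> k) (c (x k))"
    using inc(1) by (simp add: algebra_simps)
qed

lemma \<gamma>_tendsto_0:
  assumes \<gamma>hat: "\<gamma>hat \<longlonglongrightarrow> 0" and inc: "\<And>K. \<exists>k\<ge>K. t (Suc k) = t k + 1"
  shows "\<gamma> \<longlonglongrightarrow> 0"
proof -
  have "\<exists>k. N \<le> t k" for N
  proof (induction N)
    case (Suc N)
    then obtain k where "N \<le> t k" by blast
    moreover obtain j where "j \<ge> k" "t (Suc j) = t j + 1" using inc by blast
    moreover have "t k \<le> t j" using t_mono \<open>j \<ge> k\<close> by (auto dest: monoD)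
    ultimately show ?case by (intro exI[of _ "Suc j"]) simp
  qed simp
  then have "filterlim t at_top sequentially"
    unfolding filterlim_at_top eventually_sequentially
    by (meson t_mono monoD order_trans)
  then have "(\<lambda>k. \<gamma>hat (t k)) \<longlonglongrightarrow> 0" by (rule filterlim_compose[OF \<gamma>hat])
  then show ?thesis by (simp add: \<gamma>_eq[abs_def])
qed

text \<open>Along infinitely many increments, a subsequence of the iterates converges to some \<open>z\<close>, and the gradients
  of \<open>h\<^sub>\<mu>\<close>, bounded by \<open>M\<^sub>h\<close>, converge to a subgradient \<open>v\<close> of \<open>h\<close> at \<open>c z\<close>. The variational inequality,
  divided by the slope of \<open>\<Phi>\<close>, says in the limit that \<open>- Dc(z)\<^sup>* v\<close> is normal to \<open>C\<close> at \<open>z\<close>.\<close>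

lemma penalty_parameter_freezes:
  assumes CQ: "\<forall>z\<in>C. h (c z) \<ge> 0 \<longrightarrow>
       0 \<notin> limiting_subdiff (\<lambda>y. ereal (h (c y))) z + normal_cone C z"
    and \<mu>: "\<mu> \<longlonglongrightarrow> 0" and \<gamma>hat: "\<gamma>hat \<longlonglongrightarrow> 0"
  shows "\<exists>K. \<forall>j\<ge>K. t j = t K"
proof (rule ccontr)
  assume not_const: "\<not> (\<exists>K. \<forall>j\<ge>K. t j = t K)"
  have inc: "\<exists>k\<ge>K. t (Suc k) = t k + 1" for K
  proof (rule ccontr)
    assume "\<not> (\<exists>k\<ge>K. t (Suc k) = t k + 1)"
    then have stay: "t (Suc k) = t k" if "k \<ge> K" for k using that t_Suc[of k] by (metis)
    have "t j = t K" if "j \<ge> K" for j using that by (induction j rule: dec_induct) (auto simp: stay)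
    then show False using not_const by blast
  qed
  have \<gamma>0: "\<gamma> \<longlonglongrightarrow> 0" using \<gamma>_tendsto_0[OF \<gamma>hat inc] .
  have "infinite {k. t (Suc k) = t k + 1}"
    unfolding infinite_nat_iff_unbounded_le using inc by blast
  then obtain r :: "nat \<Rightarrow> nat" where r: "strict_mono r" "\<And>n. t (Suc (r n)) = t (r n) + 1"
    using infinite_enumerate[of "{k. t (Suc k) = t k + 1}"] by auto
  define g where "g k = grad (h\<^sub>\<mu> (\<mu> k)) (c (x k))" for k
  have "compact (C \<times> cball (0::'b) M\<^sub>h)" by (intro compact_Times C compact_cball)
  moreover have "\<forall>n. (x (r n), g (r n)) \<in> C \<times> cball 0 M\<^sub>h"
    using x_in_C grad_h\<^sub>\<mu>_bound[OF \<mu>_pos] by (auto simp: g_def)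
  ultimately obtain zv s where zv: "zv \<in> C \<times> cball 0 M\<^sub>h" "strict_mono (s :: nat \<Rightarrow> nat)"
    "((\<lambda>n. (x (r n), g (r n))) \<circ> s) \<longlonglongrightarrow> zv"
    unfolding compact_eq_seq_compact_metric by (rule seq_compactE)
  obtain z v where zv_eq: "zv = (z, v)" by (cases zv)
  define k where "k n = r (s n)" for n
  have k: "strict_mono k" using r(1) zv(2) by (simp add: k_def strict_mono_def)
  have lims: "(\<lambda>n. x (k n)) \<longlonglongrightarrow> z" "(\<lambda>n. g (k n)) \<longlonglongrightarrow> v"
    using tendsto_fst[OF zv(3)] tendsto_snd[OF zv(3)] by (auto simp: o_def k_def zv_eq)
  have zC: "z \<in> C" using zv by (simp add: zv_eq)
  have sub: "(\<lambda>n. u (k n)) \<longlonglongrightarrow> a" if "u \<longlonglongrightarrow> a" for u :: "nat \<Rightarrow> real" and a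
    using LIMSEQ_subseq_LIMSEQ[OF that k] by (simp add: o_def)
  note \<mu>k = sub[OF \<mu>] and \<gamma>k = sub[OF \<gamma>0]
  have inck: "t (Suc (k n)) = t (k n) + 1" for n by (simp add: k_def r(2))
  have step: "(\<lambda>n. x (Suc (k n)) - x (k n)) \<longlonglongrightarrow> 0"
  proof (rule Lim_null_comparison)
    show "eventually (\<lambda>n. norm (x (Suc (k n)) - x (k n)) \<le> c2 * \<mu> (k n) * \<gamma> (k n)) sequentially"
      using inck unfolding increment_iff by (intro always_eventually) blast
    show "(\<lambda>n. c2 * \<mu> (k n) * \<gamma> (k n)) \<longlonglongrightarrow> 0"
      using tendsto_mult[OF tendsto_mult[OF tendsto_const \<mu>k] \<gamma>k, of c2] by simp
  qed
  have next_lim: "(\<lambda>n. x (Suc (k n))) \<longlonglongrightarrow> z"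
    using tendsto_add[OF step lims(1)] by simp
  have cont: "isCont h y" "isCont c w" for y w
    using continuous_h[of UNIV] continuous_c[of UNIV] by (auto simp: continuous_on_eq_continuous_at)
  have clim: "(\<lambda>n. c (x (k n))) \<longlonglongrightarrow> c z" and cnext: "(\<lambda>n. c (x (Suc (k n)))) \<longlonglongrightarrow> c z"
    using isCont_tendsto_compose[OF cont(2)] lims(1) next_lim by auto
  have "h (c z) \<ge> 0"
  proof -
    have "(\<lambda>n. 0 - \<alpha>32h * \<mu> (k n)) \<longlonglongrightarrow> 0 - \<alpha>32h * 0" by (intro tendsto_intros \<mu>k)
    moreover have "(\<lambda>n. h (c (x (Suc (k n))))) \<longlonglongrightarrow> h (c z)"
      using isCont_tendsto_compose[OF cont(1) cnext] .
    moreover have "0 - \<alpha>32h * \<mu> (k n) \<le> h (c (x (Suc (k n))))" for n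
    proof -
      have "0 < 2 * (\<alpha>31\<phi> + \<alpha>32\<phi>) * \<mu> (k n)" using \<alpha>3\<phi>_pos \<mu>_pos by simp
      also have "\<dots> < h\<^sub>\<mu> (\<mu> (k n)) (c (x (Suc (k n))))" using inck[of n] unfolding increment_iff by blast
      finally show ?thesis using h\<^sub>\<mu>_smooth(5)[OF \<mu>_pos, of "k n" "c (x (Suc (k n)))"] by simp
    qed
    ultimately show ?thesis by (auto intro: LIMSEQ_le)
  qed
  moreover have subgrad: "h (c z) + v \<bullet> (y - c z) \<le> h y" for y
  proof -
    have "(\<lambda>n. h (c (x (k n))) - \<alpha>31h * \<mu> (k n) + g (k n) \<bullet> (y - c (x (k n)))) \<longlonglongrightarrow> h (c z) - \<alpha>31h * 0 + v \<bullet> (y - c z)"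
      by (intro tendsto_intros \<mu>k lims clim isCont_tendsto_compose[OF cont(1)])
    moreover have "(\<lambda>n. h y + \<alpha>32h * \<mu> (k n)) \<longlonglongrightarrow> h y + \<alpha>32h * 0"
      by (intro tendsto_intros \<mu>k)
    moreover have "h (c (x (k n))) - \<alpha>31h * \<mu> (k n) + g (k n) \<bullet> (y - c (x (k n))) \<le> h y + \<alpha>32h * \<mu> (k n)" for n
      using convex_above_tangent_plane[OF h\<^sub>\<mu>_smooth(1,2)[OF \<mu>_pos], where x = "c (x (k n))" and y = y]
        h\<^sub>\<mu>_smooth(4)[OF \<mu>_pos] h\<^sub>\<mu>_smooth(5)[OF \<mu>_pos]
      unfolding g_def by (meson add_right_mono order_trans)
    ultimately have "h (c z) - \<alpha>31h * 0 + v \<bullet> (y - c z) \<le> h y + \<alpha>32h * 0"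
      by (intro LIMSEQ_le) auto
    then show ?thesis by simp
  qed
  moreover have "adjoint (total_deriv c z) v \<in> limiting_subdiff (\<lambda>y. ereal (h (c y))) z"
    by (rule subgradient_chain_rule[OF subgrad C1_fun_total_deriv[OF c(1)]])
  moreover have "- adjoint (total_deriv c z) v \<in> normal_cone C z"
  proof (rule variational_inequality_normal_cone[OF zC])
    fix y assume y: "y \<in> C"
    obtain K where K: "K \<ge> 0" and var: "\<And>k. t (Suc k) = t k + 1 \<Longrightarrow> - (K * \<gamma> k) \<le> grad (g\<^sub>\<mu> (\<mu> k)) (x k) \<bullet> (y - x (Suc k))"
      using increment_variational_inequality y by blast
    have "continuous_on UNIV (total_deriv c)" using c(1) by (simp add: C1_fun_def)
    then have "isCont (total_deriv c) z" by (simp add: continuous_on_eq_continuous_at)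
    then have "(\<lambda>n. total_deriv c (x (k n))) \<longlonglongrightarrow> total_deriv c z"
      using lims(1) by (rule isCont_tendsto_compose)
    then have "(\<lambda>n. g (k n) \<bullet> total_deriv c (x (k n)) (y - x (Suc (k n)))) \<longlonglongrightarrow> v \<bullet> total_deriv c z (y - z)"
      by (intro tendsto_intros lims next_lim)
    moreover have "(\<lambda>n. - (3 * K * \<gamma> (k n))) \<longlonglongrightarrow> - (3 * K * 0)"
      by (intro tendsto_intros \<gamma>k)
    moreover have "eventually (\<lambda>n. - (3 * K * \<gamma> (k n)) \<le> g (k n) \<bullet> total_deriv c (x (k n)) (y - x (Suc (k n)))) sequentially"
    proof -
      have "(\<lambda>n. M\<^sub>h * M\<^sub>c * c2 * \<gamma> (k n)) \<longlonglongrightarrow> M\<^sub>h * M\<^sub>c * c2 * 0"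
        by (intro tendsto_intros \<gamma>k)
      then have "eventually (\<lambda>n. M\<^sub>h * M\<^sub>c * c2 * \<gamma> (k n) < (\<alpha>31\<phi> + \<alpha>32\<phi>) / 2) sequentially"
        using \<alpha>3\<phi>_pos by (intro order_tendstoD(2)) auto
      then show ?thesis
      proof eventually_elim
        case (elim n)
        define a p where "a = g (k n) \<bullet> total_deriv c (x (k n)) (y - x (Suc (k n)))"
          and "p = grad (\<Phi> (\<mu> (k n))) (h\<^sub>\<mu> (\<mu> (k n)) (c (x (k n))))"
        have p: "1/3 \<le> p" unfolding p_def using elim by (intro increment_slope inck) simp
        have pa: "- (K * \<gamma> (k n)) \<le> p * a"
          using var[OF inck[of n]] unfolding grad_g\<^sub>\<mu>[OF \<mu>_pos] p_def a_def g_def .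
        have K\<gamma>: "0 \<le> K * \<gamma> (k n)" using K \<gamma>_bounds(1)[of "k n"] by simp
        \<comment> \<open>Only a negative \<open>a\<close> needs the lower bound on the slope \<open>p\<close>.\<close>
        have "- (3 * K * \<gamma> (k n)) \<le> a"
        proof (cases "a \<ge> 0")
          case False
          then have "p * a \<le> 1/3 * a" using p by (intro mult_right_mono_neg) auto
          then show ?thesis using pa by simp
        qed (use K\<gamma> in simp)
        then show ?case by (simp add: a_def)
      qed
    qed
    ultimately have "- (3 * K * 0) \<le> v \<bullet> total_deriv c z (y - z)"
      by (intro tendsto_le[OF sequentially_bot])
    moreover have "linear (blinfun_apply (total_deriv c z))"
      using has_derivative_linear[OF C1_fun_total_deriv[OF c(1)]] .
    ultimately show "- adjoint (total_deriv c z) v \<bullet> (y - z) \<le> 0"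
      using adjoint_works[of "blinfun_apply (total_deriv c z)" "y - z" v]
      by (simp add: inner_commute)
  qed
  ultimately have "0 \<in> limiting_subdiff (\<lambda>y. ereal (h (c y))) z + normal_cone C z"
    using set_plus_intro by fastforce
  then show False using CQ zC \<open>h (c z) \<ge> 0\<close> by blast
qed

end

section \<open>Quasi-Fejer sequences and their rates\<close>

lemma powr_decrement:
  fixes n s :: real
  assumes n: "n \<ge> 1" and s: "s > 0"
  shows "s * (n + 1) powr (- s - 1) \<le> n powr (- s) - (n + 1) powr (- s)"
    "n powr (- s) - (n + 1) powr (- s) \<le> s * n powr (- s - 1)"
proof -
  have "\<exists>y>n. y < n + 1 \<and> (n + 1) powr (- s) - n powr (- s) = (n + 1 - n) * (- s * y powr (- s - 1))"
    using n by (intro MVT2) (auto intro!: derivative_eq_intros)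
  then obtain y where y: "n < y" "y < n + 1" "n powr (- s) - (n + 1) powr (- s) = s * y powr (- s - 1)"
    by auto
  have "(n + 1) powr (- s - 1) \<le> y powr (- s - 1)" "y powr (- s - 1) \<le> n powr (- s - 1)"
    using y n s by (auto intro!: powr_mono2')
  then show "s * (n + 1) powr (- s - 1) \<le> n powr (- s) - (n + 1) powr (- s)"
    "n powr (- s) - (n + 1) powr (- s) \<le> s * n powr (- s - 1)"
    using y(3) s by auto
qed

lemma powr_shift_lower:
  fixes n s :: real
  assumes "n \<ge> 1" "s \<ge> 0"
  shows "2 powr (- s) * n powr (- s) \<le> (n + 1) powr (- s)"
proof -
  have "(2 * n) powr (- s) \<le> (n + 1) powr (- s)" using assms by (intro powr_mono2') auto
  then show ?thesis using assms by (simp add: powr_mult)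
qed

text \<open>Induction on \<open>k\<close>: if \<open>W\<close> exceeded \<open>A (1 + k)\<^sup>-\<^sup>\<sigma>\<close> at \<open>k + 1\<close> but not at \<open>k\<close>, then the decrease
  \<open>a m W\<^sup>p\<close>, at least of order \<open>A\<^sup>p n\<^sup>-\<^sup>r\<^sup>-\<^sup>\<sigma>\<^sup>p\<close> with \<open>n = 1 + k\<close>, would be less than the loss
  \<open>A \<sigma> n\<^sup>-\<^sup>\<sigma>\<^sup>-\<^sup>1\<close> of the majorant plus the error \<open>B b2\<^sup>2 n\<^sup>-\<^sup>2\<^sup>r\<close>. The conditions on \<open>\<sigma>\<close> guarantee that
  neither of the last two powers of \<open>n\<close> exceeds the first one, which leaves a comparison of
  coefficients: \<open>A\<^sup>p\<close> beats \<open>A\<close> for large \<open>A\<close> because \<open>p > 1\<close>.\<close>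

lemma superlinear_recursion_rate:
  fixes W m :: "nat \<Rightarrow> real" and p r \<sigma> a B b1 b2 :: real
  assumes p: "p > 1" and \<sigma>: "0 < \<sigma>" "\<sigma> \<le> 2 * r - 1" "\<sigma> * (p - 1) \<le> 1 - r"
    and a: "a > 0" and B: "B \<ge> 0" and b: "b1 > 0" "b2 > 0"
    and W0: "\<And>k. k \<ge> K \<Longrightarrow> 0 \<le> W k"
    and m: "\<And>k. k \<ge> K \<Longrightarrow> b1 * (1 + real k) powr (- r) \<le> m k \<and> m k \<le> b2 * (1 + real k) powr (- r)"
    and rec: "\<And>k. k \<ge> K \<Longrightarrow> W (Suc k) \<le> W k - a * m k * W (Suc k) powr p + B * (m k)\<^sup>2"
  shows "\<exists>A>0. \<forall>k\<ge>K. W k \<le> A * (1 + real k) powr (- \<sigma>)"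
proof -
  define d where "d = a * b1 * 2 powr (- (\<sigma> * p))"
  have d: "d > 0" using a b by (simp add: d_def)
  define e where "e = \<sigma> + B * b2\<^sup>2"
  have e: "e > 0" using \<sigma> B by (simp add: e_def add_pos_nonneg)
  \<comment> \<open>The first two entries make \<open>d * A powr p\<close> dominate \<open>e * A\<close>, the last one starts the induction.\<close>
  define A where "A = max (max 1 ((e / d) powr (1 / (p - 1)))) (W K * (1 + real K) powr \<sigma>)"
  have A1: "A \<ge> 1" by (simp add: A_def)
  have Ae: "e * A \<le> d * A powr p"
  proof -
    have "e / d = ((e / d) powr (1 / (p - 1))) powr (p - 1)" using p d e by (simp add: powr_powr)
    also have "\<dots> \<le> A powr (p - 1)" using p by (intro powr_mono2) (auto simp: A_def)
    finally have "e \<le> d * A powr (p - 1)" using d by (simp add: field_simps)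
    then have "e * A \<le> d * A powr (p - 1) * A" using A1 by (intro mult_right_mono) auto
    also have "\<dots> = d * A powr p" using A1 by (simp add: powr_diff)
    finally show ?thesis .
  qed
  have "W k \<le> A * (1 + real k) powr (- \<sigma>)" if "k \<ge> K" for k
    using that
  proof (induction k rule: dec_induct)
    case base
    have "W K * (1 + real K) powr \<sigma> \<le> A" by (simp add: A_def)
    then show ?case by (simp add: powr_minus field_simps)
  next
    case (step k)
    define n where "n = 1 + real k"
    have n: "n \<ge> 1" "1 + real (Suc k) = n + 1" by (auto simp: n_def)
    show ?case
    proof (rule ccontr)
      assume "\<not> ?case"
      then have big: "A * (n + 1) powr (- \<sigma>) < W (Suc k)" unfolding n(2) by simp
      have mk: "b1 * n powr (- r) \<le> m k" "m k \<le> b2 * n powr (- r)" using m[OF step(1)] by (auto simp: n_def)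
      have m0: "0 \<le> m k" using mk(1) b(1) by (meson less_imp_le mult_nonneg_nonneg order_trans powr_ge_zero)
      have "A powr p * (2 powr (- (\<sigma> * p)) * n powr (- (\<sigma> * p))) \<le> A powr p * (n + 1) powr (- (\<sigma> * p))"
        using powr_shift_lower[OF n(1), of "\<sigma> * p"] \<sigma> p by (intro mult_left_mono) auto
      also have "\<dots> = (A * (n + 1) powr (- \<sigma>)) powr p"
        using A1 n by (simp add: powr_mult powr_powr)
      also have "\<dots> \<le> W (Suc k) powr p" using big p A1 n by (intro powr_mono2) auto
      finally have Wp: "A powr p * (2 powr (- (\<sigma> * p)) * n powr (- (\<sigma> * p))) \<le> W (Suc k) powr p" .
      have "(a * (b1 * n powr (- r))) * (A powr p * (2 powr (- (\<sigma> * p)) * n powr (- (\<sigma> * p)))) \<le> a * m k * W (Suc k) powr p"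
        using Wp mk a b m0 by (intro mult_mono) auto
      moreover have "(a * (b1 * n powr (- r))) * (A powr p * (2 powr (- (\<sigma> * p)) * n powr (- (\<sigma> * p))))
          = d * A powr p * n powr (- r - \<sigma> * p)"
        using n by (simp add: d_def powr_add[symmetric] mult_ac)
      moreover have "W (Suc k) \<le> A * n powr (- \<sigma>) - a * m k * W (Suc k) powr p + B * (m k)\<^sup>2"
        using rec[OF step(1)] step.IH by (simp add: n_def)
      moreover have "A * n powr (- \<sigma>) - A * (n + 1) powr (- \<sigma>) \<le> A * (\<sigma> * n powr (- r - \<sigma> * p))"
      proof -
        have "n powr (- \<sigma>) - (n + 1) powr (- \<sigma>) \<le> \<sigma> * n powr (- \<sigma> - 1)"
          using powr_decrement(2)[OF n(1) \<sigma>(1)] .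
        also have "\<dots> \<le> \<sigma> * n powr (- r - \<sigma> * p)"
          using \<sigma> n by (intro mult_left_mono powr_mono) (auto simp: algebra_simps)
        finally show ?thesis using A1 by (simp flip: right_diff_distrib)
      qed
      moreover have "B * (m k)\<^sup>2 \<le> A * (B * b2\<^sup>2 * n powr (- r - \<sigma> * p))"
      proof -
        have "(m k)\<^sup>2 \<le> (b2 * n powr (- r))\<^sup>2" using mk m0 by (intro power_mono) auto
        also have "\<dots> = b2\<^sup>2 * n powr (- r - r)"
          by (simp add: power_mult_distrib power2_eq_square powr_add[symmetric])
        also have "\<dots> \<le> b2\<^sup>2 * n powr (- r - \<sigma> * p)"
          using \<sigma> n by (intro mult_left_mono powr_mono) (auto simp: algebra_simps)
        finally have "B * (m k)\<^sup>2 \<le> 1 * (B * (b2\<^sup>2 * n powr (- r - \<sigma> * p)))"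
          using B by (simp add: mult_left_mono)
        also have "\<dots> \<le> A * (B * (b2\<^sup>2 * n powr (- r - \<sigma> * p)))"
          using A1 B by (intro mult_right_mono) auto
        finally show ?thesis by (simp add: mult_ac)
      qed
      moreover have e: "e * A * n powr (- r - \<sigma> * p)
          = A * (\<sigma> * n powr (- r - \<sigma> * p)) + A * (B * b2\<^sup>2 * n powr (- r - \<sigma> * p))"
        by (simp add: e_def algebra_simps)
      ultimately have "d * A powr p * n powr (- r - \<sigma> * p) < e * A * n powr (- r - \<sigma> * p)"
        using big unfolding e by linarith
      moreover have "e * A * n powr (- r - \<sigma> * p) \<le> d * A powr p * n powr (- r - \<sigma> * p)"
        using Ae by (intro mult_right_mono) auto
      ultimately show False by linarith
    qed
  qed
  then show ?thesis using A1 by (intro exI[of _ A]) auto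
qed

text \<open>The distance of \<open>x k\<close> to each point of \<open>S\<close> decreases up to summable errors, and \<open>u\<close> measures the
  optimality gap. The term with \<open>u k - u (Suc k)\<close> telescopes because \<open>\<mu>\<close> is decreasing.\<close>

locale quasi_fejer =
  fixes S :: "'a::euclidean_space set" and x :: "nat \<Rightarrow> 'a" and u \<mu> :: "nat \<Rightarrow> real"
    and a B b1 b2 r :: real and K :: nat
  assumes S_nonempty: "S \<noteq> {}"
    and u_nonneg: "\<And>k. k \<ge> K \<Longrightarrow> 0 \<le> u k"
    and u_decreasing: "\<And>k. k \<ge> K \<Longrightarrow> u (Suc k) \<le> u k"
    and a: "a > 0" and B: "B \<ge> 0"
    and fejer: "\<And>k z. k \<ge> K \<Longrightarrow> z \<in> S \<Longrightarrow>
       (norm (z - x (Suc k)))\<^sup>2 \<le> (norm (z - x k))\<^sup>2 - a * \<mu> k * u (Suc k) + B * (\<mu> k)\<^sup>2 + B * \<mu> k * (u k - u (Suc k))"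
    and \<mu>: "\<And>k. 0 < \<mu> k" "decseq \<mu>" "\<mu> \<longlonglongrightarrow> 0" "\<not> summable \<mu>"
    and r: "1/2 < r" and b: "b1 > 0" "b2 > 0"
    and \<mu>_rate: "\<And>k. k \<ge> K \<Longrightarrow> b1 * (1 + real k) powr (- r) \<le> \<mu> k \<and> \<mu> k \<le> b2 * (1 + real k) powr (- r)"
begin

lemma fejer_with_gap:
  assumes "k \<ge> K" "z \<in> S"
  shows "(norm (z - x (Suc k)))\<^sup>2 + B * \<mu> (Suc k) * u (Suc k)
     \<le> (norm (z - x k))\<^sup>2 + B * \<mu> k * u k - a * \<mu> k * u (Suc k) + B * (\<mu> k)\<^sup>2"
proof -
  have "B * \<mu> (Suc k) * u (Suc k) \<le> B * \<mu> k * u (Suc k)"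
    using decseqD[OF \<mu>(2), of k "Suc k"] u_nonneg[of "Suc k"] assms B
    by (intro mult_right_mono mult_left_mono) auto
  then show ?thesis using fejer[OF assms] by (simp add: algebra_simps)
qed

text \<open>An explicit majorant of the tail sums of \<open>B * (\<mu> k)\<^sup>2\<close>, chosen so that its decrements dominate the
  terms; its order is that of the tail sums.\<close>

definition tail :: "nat \<Rightarrow> real" where
  "tail k = B * b2\<^sup>2 * 2 powr (2 * r) / (2 * r - 1) * (1 + real k) powr (- (2 * r - 1))"

lemma tail_nonneg: "tail k \<ge> 0"
  using B r by (simp add: tail_def)

lemma tail_decrement:
  assumes "k \<ge> K"
  shows "B * (\<mu> k)\<^sup>2 \<le> tail k - tail (Suc k)"
proof -
  define n where "n = 1 + real k"
  have n: "n \<ge> 1" "1 + real (Suc k) = n + 1" by (auto simp: n_def)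
  define s where "s = 2 * r - 1"
  have s: "s > 0" using r by (simp add: s_def)
  have "(\<mu> k)\<^sup>2 \<le> (b2 * n powr (- r))\<^sup>2"
    using \<mu>_rate[OF assms] \<mu>(1)[of k] by (intro power_mono) (auto simp: n_def)
  also have "\<dots> = b2\<^sup>2 * n powr (- (2 * r))"
    by (simp add: power_mult_distrib power2_eq_square powr_add[symmetric])
  finally have "B * (\<mu> k)\<^sup>2 \<le> B * (b2\<^sup>2 * n powr (- (2 * r)))" using B by (rule mult_left_mono)
  also have "\<dots> = B * b2\<^sup>2 * 2 powr (2 * r) / s * (s * (2 powr (- (2 * r)) * n powr (- (2 * r))))"
    using s by (simp add: powr_minus field_simps)
  also have "\<dots> \<le> B * b2\<^sup>2 * 2 powr (2 * r) / s * (s * (n + 1) powr (- (2 * r)))"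
    using powr_shift_lower[OF n(1), of "2 * r"] r B s by (intro mult_left_mono) auto
  also have "\<dots> \<le> B * b2\<^sup>2 * 2 powr (2 * r) / s * (n powr (- s) - (n + 1) powr (- s))"
    using powr_decrement(1)[OF n(1) s] B s
    by (intro mult_left_mono) (auto simp: s_def)
  also have "\<dots> = tail k - tail (Suc k)"
    unfolding tail_def n(2) n_def[symmetric] s_def[symmetric] by (simp add: right_diff_distrib)
  finally show ?thesis .
qed

lemma tail_tendsto_0: "tail \<longlonglongrightarrow> 0"
proof -
  have "(\<lambda>k. (1 + real k) powr (- (2 * r - 1))) \<longlonglongrightarrow> 0"
    using r by (intro tendsto_neg_powr filterlim_tendsto_add_at_top[OF tendsto_const]
      filterlim_real_sequentially) auto
  from tendsto_mult_right_zero[OF this] show ?thesis unfolding tail_def[abs_def] .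
qed

definition potential :: "'a \<Rightarrow> nat \<Rightarrow> real" where
  "potential z k = (norm (z - x k))\<^sup>2 + B * \<mu> k * u k + tail k"

lemma potential_Suc:
  assumes "k \<ge> K" "z \<in> S"
  shows "potential z (Suc k) + a * \<mu> k * u (Suc k) \<le> potential z k"
  using fejer_with_gap[OF assms] tail_decrement[OF assms(1)] by (simp add: potential_def)

lemma potential_antimono:
  assumes "K \<le> k" "k \<le> j" "z \<in> S"
  shows "potential z j \<le> potential z k"
  using assms(2)
proof (induction j rule: dec_induct)
  case (step j)
  have "0 \<le> a * \<mu> j * u (Suc j)" using a \<mu>(1)[of j] u_nonneg[of "Suc j"] assms(1) step by simp
  then show ?case using potential_Suc[of j z] step assms by simp
qed simp

lemma norm_le_potential:
  assumes "K \<le> k"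
  shows "(norm (z - x k))\<^sup>2 \<le> potential z k"
  using B \<mu>(1)[of k] u_nonneg[OF assms] tail_nonneg[of k] by (simp add: potential_def)

lemma u_antimono:
  assumes "K \<le> k" "k \<le> j"
  shows "u j \<le> u k"
  using assms(2) by (induction j rule: dec_induct) (use assms(1) in \<open>auto intro: order_trans[OF u_decreasing]\<close>)

text \<open>The potential pays \<open>a * \<mu> k * u (Suc k)\<close> in each step and stays nonnegative, so a decreasing \<open>u\<close>
  bounded away from \<open>0\<close> would make \<open>\<mu>\<close> summable.\<close>

lemma u_tendsto_0: "u \<longlonglongrightarrow> 0"
proof (rule LIMSEQ_I)
  fix e :: real assume e: "e > 0"
  have "\<exists>k\<ge>K. u k < e"
  proof (rule ccontr)
    assume "\<not> ?thesis"
    then have large: "e \<le> u k" if "k \<ge> K" for k using that by (meson not_less)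
    obtain z where z: "z \<in> S" using S_nonempty by blast
    have partial: "potential z (K + n) + a * e * (\<Sum>i<n. \<mu> (i + K)) \<le> potential z K" for n
    proof (induction n)
      case (Suc n)
      have "a * \<mu> (K + n) * e \<le> a * \<mu> (K + n) * u (Suc (K + n))"
        using large[of "Suc (K + n)"] a \<mu>(1)[of "K + n"] by (intro mult_left_mono) auto
      then show ?case using potential_Suc[of "K + n" z] Suc z by (simp add: algebra_simps)
    qed simp
    have "(\<Sum>i<n. \<mu> (i + K)) \<le> potential z K / (a * e)" for n
    proof -
      have "0 \<le> potential z (K + n)" using norm_le_potential[of "K + n" z] by (auto intro: order_trans[rotated])
      then show ?thesis using partial[of n] a e by (simp add: field_simps)
    qed
    then have "summable (\<lambda>i. \<mu> (i + K))"
      using \<mu>(1) by (intro summableI_nonneg_bounded) (auto simp: less_imp_le)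
    then show False using \<mu>(4) by (simp add: summable_iff_shift)
  qed
  then obtain k where k: "k \<ge> K" "u k < e" by blast
  show "\<exists>n0. \<forall>n\<ge>n0. norm (u n - 0) < e"
  proof (intro exI[of _ k] allI impI)
    fix n assume "n \<ge> k"
    then show "norm (u n - 0) < e"
      using u_antimono[OF k(1), of n] u_nonneg[of n] k by simp
  qed
qed

text \<open>The potential of the cluster point is decreasing and tends to \<open>0\<close> along a subsequence.\<close>

lemma convergence_from_cluster_point:
  assumes z: "z \<in> S" and s: "strict_mono s" "(x \<circ> s) \<longlonglongrightarrow> z"
  shows "x \<longlonglongrightarrow> z"
proof -
  have "(\<lambda>n. potential z (s n)) \<longlonglongrightarrow> (norm (z - z))\<^sup>2 + B * 0 * 0 + 0"
    unfolding potential_def using s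
    by (intro tendsto_intros LIMSEQ_subseq_LIMSEQ[OF \<mu>(3) s(1), unfolded o_def]
        LIMSEQ_subseq_LIMSEQ[OF u_tendsto_0 s(1), unfolded o_def]
        LIMSEQ_subseq_LIMSEQ[OF tail_tendsto_0 s(1), unfolded o_def]) (simp add: o_def)
  then have Vs: "(\<lambda>n. potential z (s n)) \<longlonglongrightarrow> 0" by simp
  have "(\<lambda>k. (norm (z - x k))\<^sup>2) \<longlonglongrightarrow> 0"
  proof (rule LIMSEQ_I)
    fix e :: real assume "e > 0"
    then have "eventually (\<lambda>n. potential z (s n) < e \<and> n \<ge> K) sequentially"
      using order_tendstoD(2)[OF Vs] by (intro eventually_conj eventually_ge_at_top) auto
    then obtain n where n: "potential z (s n) < e" "n \<ge> K"
      using eventually_happens'[OF sequentially_bot] by blast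
    have sK: "s n \<ge> K" using seq_suble[OF s(1), of n] n by simp
    show "\<exists>n0. \<forall>k\<ge>n0. norm ((norm (z - x k))\<^sup>2 - 0) < e"
    proof (intro exI[of _ "s n"] allI impI)
      fix k assume "k \<ge> s n"
      then show "norm ((norm (z - x k))\<^sup>2 - 0) < e"
        using potential_antimono[OF sK, of k z] norm_le_potential[of k z] z n sK by simp
    qed
  qed
  then have "(\<lambda>k. sqrt ((norm (z - x k))\<^sup>2)) \<longlonglongrightarrow> sqrt 0" by (rule tendsto_real_sqrt)
  then have "(\<lambda>k. norm (x k - z)) \<longlonglongrightarrow> 0" by (simp add: norm_minus_commute)
  then show ?thesis by (simp add: tendsto_norm_zero_iff LIM_zero_iff)
qed

text \<open>Let \<open>z\<close> be a projection of \<open>x k\<close> onto \<open>\<Omega>\<close>. All later iterates, and hence their limit, remain within the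
  square root of the potential of \<open>z\<close> at time \<open>k\<close>, so \<open>|x k - xbar|\<close> is at most twice this root. The
  potential equals \<open>W k + tail k\<close>, where \<open>W\<close> obeys the superlinear recursion.\<close>

lemma rate_from_error_bound:
  assumes lim: "x \<longlonglongrightarrow> xbar"
    and \<Omega>: "\<Omega> \<subseteq> S" "closed \<Omega>" "\<Omega> \<noteq> {}"
    and eb: "H \<ge> 0" "\<And>k. k \<ge> N \<Longrightarrow> (infdist (x k) \<Omega>)\<^sup>2 \<le> H * u k powr (1 / p)"
    and p: "p > 1" and \<sigma>: "0 < \<sigma>" "\<sigma> \<le> 2 * r - 1" "\<sigma> * (p - 1) \<le> 1 - r"
  shows "\<exists>A>0. \<exists>k'. \<forall>k\<ge>k'. norm (x k - xbar) \<le> A * (1 + real k) powr (- (\<sigma> / 2))"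
proof -
  obtain N1 where N1: "\<And>k. k \<ge> N1 \<Longrightarrow> u k < 1"
    using order_tendstoD(2)[OF u_tendsto_0, of 1] by (auto simp: eventually_sequentially)
  define M where "M = max K (max N N1)"
  define W where "W k = (infdist (x k) \<Omega>)\<^sup>2 + B * \<mu> k * u k" for k
  \<comment> \<open>The summand \<open>1\<close> only makes \<open>H'\<close> positive.\<close>
  define H' where "H' = H + B * \<mu> 0 + 1"
  have H': "H' > 0" using eb(1) B \<mu>(1)[of 0] by (simp add: H'_def add_nonneg_pos)
  have proj: "\<exists>z\<in>\<Omega>. infdist (x k) \<Omega> = norm (z - x k)" for k
    using infdist_attains_inf[OF \<Omega>(2,3), of "x k"] by (metis dist_commute dist_norm)
  have W0: "0 \<le> W k" if "k \<ge> M" for k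
    using that u_nonneg[of k] B \<mu>(1)[of k] by (simp add: W_def M_def)
  have uW: "(1 / H') powr p * W k powr p \<le> u k" if "k \<ge> M" for k
  proof -
    have u: "0 \<le> u k" "u k \<le> 1" using that u_nonneg[of k] N1[of k] by (auto simp: M_def)
    have "u k = (u k powr (1 / p)) powr p" using u p by (simp add: powr_powr)
    have up: "u k \<le> u k powr (1 / p)"
    proof (cases "u k = 0")
      case False
      then show ?thesis using powr_mono'[of "1 / p" 1 "u k"] u p by simp
    qed simp
    have "B * \<mu> k * u k \<le> B * \<mu> 0 * u k powr (1 / p)"
      using up decseqD[OF \<mu>(2), of 0 k] B u \<mu>(1)[of 0] by (intro mult_mono mult_left_mono) auto
    then have "W k \<le> (H + B * \<mu> 0) * u k powr (1 / p)"
      using eb(2)[of k] that by (simp add: W_def M_def algebra_simps)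
    also have "\<dots> \<le> H' * u k powr (1 / p)" by (intro mult_right_mono) (auto simp: H'_def)
    finally have "1 / H' * W k \<le> u k powr (1 / p)" using H' by (simp add: field_simps)
    then have "(1 / H' * W k) powr p \<le> (u k powr (1 / p)) powr p"
      using p H' W0[OF that] by (intro powr_mono2) auto
    then show ?thesis using u p H' W0[OF that] by (simp add: powr_mult powr_powr powr_divide)
  qed
  have "\<exists>A>0. \<forall>k\<ge>M. W k \<le> A * (1 + real k) powr (- \<sigma>)"
  proof (rule superlinear_recursion_rate[where m = \<mu> and a = "a * (1 / H') powr p", OF p \<sigma> _ B b W0])
    show "a * (1 / H') powr p > 0" using a H' by simp
    fix k assume k: "k \<ge> M"
    then have kK: "k \<ge> K" by (simp add: M_def)
    show "b1 * (1 + real k) powr (- r) \<le> \<mu> k \<and> \<mu> k \<le> b2 * (1 + real k) powr (- r)"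
      using \<mu>_rate[OF kK] .
    obtain z where z: "z \<in> \<Omega>" "infdist (x k) \<Omega> = norm (z - x k)" using proj by blast
    have "infdist (x (Suc k)) \<Omega> \<le> norm (z - x (Suc k))"
      using infdist_le[OF z(1), of "x (Suc k)"] by (simp add: dist_norm norm_minus_commute)
    then have "(infdist (x (Suc k)) \<Omega>)\<^sup>2 \<le> (norm (z - x (Suc k)))\<^sup>2"
      by (intro power_mono infdist_nonneg)
    then have "W (Suc k) \<le> W k - a * \<mu> k * u (Suc k) + B * (\<mu> k)\<^sup>2"
      using fejer_with_gap[OF kK, of z] z \<Omega>(1) by (auto simp: W_def)
    moreover have "a * \<mu> k * ((1 / H') powr p * W (Suc k) powr p) \<le> a * \<mu> k * u (Suc k)"
      using uW[of "Suc k"] k a \<mu>(1)[of k] by (intro mult_left_mono) auto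
    ultimately show "W (Suc k) \<le> W k - a * (1 / H') powr p * \<mu> k * W (Suc k) powr p + B * (\<mu> k)\<^sup>2"
      by (simp add: mult_ac)
  qed
  then obtain A where A: "A > 0" "\<And>k. k \<ge> M \<Longrightarrow> W k \<le> A * (1 + real k) powr (- \<sigma>)" by blast
  define T where "T = B * b2\<^sup>2 * 2 powr (2 * r) / (2 * r - 1)"
  have T: "T \<ge> 0" using B r by (simp add: T_def)
  define A' where "A' = 2 * sqrt (A + T)"
  have "norm (x k - xbar) \<le> A' * (1 + real k) powr (- (\<sigma> / 2))" if k: "k \<ge> M" for k
  proof -
    have kK: "k \<ge> K" using k by (simp add: M_def)
    obtain z where z: "z \<in> \<Omega>" "infdist (x k) \<Omega> = norm (z - x k)" using proj by blast
    have zS: "z \<in> S" using z \<Omega> by blast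
    have VW: "potential z k = W k + tail k" using z by (simp add: potential_def W_def)
    have "(\<lambda>j. (norm (z - x j))\<^sup>2) \<longlonglongrightarrow> (norm (z - xbar))\<^sup>2" by (intro tendsto_intros lim)
    moreover have "eventually (\<lambda>j. (norm (z - x j))\<^sup>2 \<le> potential z k) sequentially"
      using eventually_ge_at_top[of k]
    proof eventually_elim
      case (elim j)
      then show ?case using norm_le_potential[of j z] potential_antimono[OF kK elim zS] kK by linarith
    qed
    ultimately have "(norm (z - xbar))\<^sup>2 \<le> potential z k" by (intro tendsto_upperbound) auto
    then have 1: "norm (z - xbar) \<le> sqrt (potential z k)" by (rule real_le_rsqrt)
    have 2: "norm (z - x k) \<le> sqrt (potential z k)" using norm_le_potential[OF kK] by (rule real_le_rsqrt)
    have "norm (x k - xbar) \<le> norm (z - xbar) + norm (z - x k)"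
      using norm_triangle_ineq4[of "z - xbar" "z - x k"] by simp
    also have "\<dots> \<le> 2 * sqrt (potential z k)" using 1 2 by simp
    also have "potential z k \<le> (A + T) * (1 + real k) powr (- \<sigma>)"
    proof -
      have "tail k \<le> T * (1 + real k) powr (- \<sigma>)"
        unfolding tail_def T_def[symmetric] using T \<sigma> by (intro mult_left_mono powr_mono) auto
      then show ?thesis using A(2)[OF k] by (simp add: VW algebra_simps)
    qed
    also have "sqrt ((A + T) * (1 + real k) powr (- \<sigma>)) = sqrt (A + T) * (1 + real k) powr (- (\<sigma> / 2))"
      by (simp add: real_sqrt_mult powr_half_sqrt[symmetric] powr_powr)
    finally show ?thesis by (simp add: A'_def)
  qed
  moreover have "A' > 0" using A T by (simp add: A'_def)
  ultimately show ?thesis by blast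
qed

end

section \<open>Convergence once the penalty parameter is constant\<close>

lemma not_summable_if_tail_sums_unbounded:
  fixes m :: "nat \<Rightarrow> real"
  assumes "\<And>k. m k \<ge> 0"
    and "filterlim (\<lambda>K. \<Sum>k = nat \<lceil>real K / 2\<rceil>..K. m k) at_top sequentially"
  shows "\<not> summable m"
proof
  assume s: "summable m"
  have "eventually (\<lambda>K. suminf m < (\<Sum>k = nat \<lceil>real K / 2\<rceil>..K. m k)) sequentially"
    using assms(2) by (simp add: filterlim_at_top_dense)
  then obtain K where "suminf m < (\<Sum>k = nat \<lceil>real K / 2\<rceil>..K. m k)"
    using eventually_happens'[OF sequentially_bot] by blast
  also have "\<dots> \<le> suminf m" using assms(1) by (intro sum_le_suminf s) auto
  finally show False by simp
qed

text \<open>A run whose penalty parameter equals \<open>\<gamma>bar\<close> from iteration \<open>K\<close> on.\<close>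

locale frozen_sESQM_run = sESQM_run +
  fixes \<gamma>bar b1 b2 r :: real and K :: nat
  assumes frozen: "\<And>k. k \<ge> K \<Longrightarrow> \<gamma> k = \<gamma>bar" "\<And>k. k \<ge> K \<Longrightarrow> t (Suc k) \<noteq> t k + 1"
    and \<mu>_lim: "\<mu> \<longlonglongrightarrow> 0" and \<mu>_div: "\<not> summable \<mu>"
    and rate: "1/2 < r" "b1 > 0" "b2 > 0"
      "\<And>k. k \<ge> K \<Longrightarrow> b1 * (1 + real k) powr (- r) \<le> \<mu> k \<and> \<mu> k \<le> b2 * (1 + real k) powr (- r)"
begin

definition penalty :: "'a \<Rightarrow> real" where
  "penalty z = \<gamma>bar * (f z + P1 z) + pos_part (h (c z))"

definition minimizers :: "'a set" where
  "minimizers = {z \<in> C. \<forall>w\<in>C. penalty z \<le> penalty w}"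

definition penalty_min :: real where
  "penalty_min = (INF z\<in>C. penalty z)"

text \<open>Multiplied by \<open>\<mu> k\<close>, the first two summands absorb the change of the merit function when \<open>\<mu>\<close> is
  updated and the last one its distance to \<open>penalty\<close>. So \<open>u\<close> is both decreasing and an upper bound of
  the penalty gap.\<close>

definition drift :: real where
  "drift = \<alpha>4h + \<alpha>4\<phi> + \<beta>"

definition u :: "nat \<Rightarrow> real" where
  "u k = merit k (x k) + drift * \<mu> k - penalty_min"

lemma \<gamma>bar_pos: "\<gamma>bar > 0"
  using frozen(1)[of K] \<gamma>_bounds(1)[of K] by simp

lemma continuous_penalty: "continuous_on X penalty"
  unfolding penalty_def pos_part_def
  by (intro continuous_intros continuous_f continuous_P1 continuous_hc)

lemma minimizers_nonempty: "minimizers \<noteq> {}"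
  using continuous_attains_inf[OF C(1) C_nonempty continuous_penalty] by (auto simp: minimizers_def)

lemma penalty_minimal: "z \<in> minimizers \<Longrightarrow> penalty z = penalty_min"
  unfolding penalty_min_def minimizers_def by (intro cInf_eq_minimum[symmetric]) auto

lemma penalty_min_le: "z \<in> C \<Longrightarrow> penalty_min \<le> penalty z"
  using penalty_minimal minimizers_nonempty by (force simp: minimizers_def)

lemma merit_close: "k \<ge> K \<Longrightarrow> \<bar>merit k z - penalty z\<bar> \<le> \<beta> * \<mu> k"
  using g\<^sub>\<mu>_close[OF \<mu>_pos, of k z] frozen(1)[of k] by (simp add: merit_def penalty_def)

lemma \<alpha>4_nonneg: "\<alpha>4h + \<alpha>4\<phi> \<ge> 0"
  using g\<^sub>\<mu>_parameter_controlled by (simp add: parameter_controlled_def)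

lemma drift_nonneg: "drift \<ge> 0"
  using \<alpha>4_nonneg \<beta>_nonneg by (simp add: drift_def)

lemma penalty_gap_le_u:
  assumes "k \<ge> K"
  shows "penalty (x k) - penalty_min \<le> u k"
proof -
  have "\<beta> * \<mu> k \<le> drift * \<mu> k" using \<alpha>4_nonneg \<mu>_pos[of k] by (intro mult_right_mono) (auto simp: drift_def)
  then show ?thesis using merit_close[OF assms, of "x k"] by (simp add: u_def abs_le_iff)
qed

lemma u_nonneg: "k \<ge> K \<Longrightarrow> 0 \<le> u k"
  using penalty_gap_le_u[of k] penalty_min_le[OF x_in_C, of k] by simp

lemma u_Suc_le:
  assumes "k \<ge> K"
  shows "u (Suc k) \<le> merit k (x (Suc k)) + drift * \<mu> k - penalty_min"
proof -
  have \<mu>: "\<mu> (Suc k) \<le> \<mu> k" using decseqD[OF \<mu>_decreasing, of k "Suc k"] by simp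
  have "g\<^sub>\<mu> (\<mu> (Suc k)) (x (Suc k)) \<le> g\<^sub>\<mu> (\<mu> k) (x (Suc k)) + (\<alpha>4h + \<alpha>4\<phi>) * (\<mu> k - \<mu> (Suc k))"
    using g\<^sub>\<mu>_parameter_controlled \<mu> \<mu>_pos by (auto simp: parameter_controlled_def)
  also have "(\<alpha>4h + \<alpha>4\<phi>) * (\<mu> k - \<mu> (Suc k)) \<le> drift * (\<mu> k - \<mu> (Suc k))"
    using \<mu> \<beta>_nonneg by (intro mult_right_mono) (auto simp: drift_def)
  finally show ?thesis
    using frozen(1)[of k] frozen(1)[of "Suc k"] assms by (simp add: u_def merit_def algebra_simps)
qed

lemma u_descent:
  assumes "k \<ge> K"
  shows "u (Suc k) \<le> u k - c1 / (2 * \<mu> k) * (norm (x (Suc k) - x k))\<^sup>2"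
  using u_Suc_le[OF assms] descent[of k] by (simp add: u_def)

text \<open>The fundamental inequality, multiplied by \<open>2 \<mu> / L\<close>. The terms of known sign are estimated with the
  bounds on \<open>L\<close>; the smoothing error \<open>O(\<mu>)\<close> of the merit function turns into the summable \<open>O(\<mu>\<^sup>2)\<close>.\<close>

lemma distance_inequality:
  assumes k: "k \<ge> K" and z: "z \<in> minimizers"
  shows "(norm (z - x (Suc k)))\<^sup>2 \<le> (norm (z - x k))\<^sup>2 - 2 / Lmax * \<mu> k * u (Suc k)
     + 2 / Llow * (drift + \<beta> + 2 * model_curvature / c1) * (\<mu> k)\<^sup>2
     + 2 / Llow * (drift + \<beta> + 2 * model_curvature / c1) * \<mu> k * (u k - u (Suc k))"
proof -
  define a a' d where "a = (norm (z - x k))\<^sup>2" and "a' = (norm (z - x (Suc k)))\<^sup>2" and "d = u k - u (Suc k)"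
  define l where "l = 2 / L k"
  have L: "0 < L k" "Llow \<le> L k" "L k \<le> Lmax" using L_bounds[of k] constants(1) by auto
  have l: "2 / Lmax \<le> l" "l \<le> 2 / Llow" "0 < l"
    using L constants(1) by (auto simp: l_def intro: divide_left_mono)
  have zC: "z \<in> C" using z by (simp add: minimizers_def)
  have d0: "d \<ge> 0" using u_descent[OF k] constants(3) \<mu>_pos[of k]
    by (simp add: d_def) (smt (verit) divide_nonneg_nonneg mult_nonneg_nonneg zero_le_power2)
  have "merit k (x k) - merit k (x (Suc k)) \<le> d" using u_Suc_le[OF k] by (simp add: d_def u_def)
  then have "2 * model_curvature / c1 * (merit k (x k) - merit k (x (Suc k))) \<le> 2 * model_curvature / c1 * d"
    using model_curvature_nonneg constants(3) by (intro mult_left_mono) auto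
  moreover have "merit k z \<le> penalty_min + \<beta> * \<mu> k" using merit_close[OF k, of z] penalty_minimal[OF z] by (simp add: abs_le_iff)
  ultimately have "u (Suc k) \<le> (drift + \<beta>) * \<mu> k + L k / (2 * \<mu> k) * (a - a') + 2 * model_curvature / c1 * d"
    using u_Suc_le[OF k] fundamental_inequality[OF zC, of k] by (simp add: a_def a'_def algebra_simps)
  then have "l * \<mu> k * u (Suc k) \<le> l * \<mu> k * ((drift + \<beta>) * \<mu> k + L k / (2 * \<mu> k) * (a - a') + 2 * model_curvature / c1 * d)"
    using l \<mu>_pos[of k] by (intro mult_left_mono) auto
  also have "\<dots> = (a - a') + l * ((drift + \<beta>) * (\<mu> k)\<^sup>2 + 2 * model_curvature / c1 * \<mu> k * d)"
    using L \<mu>_pos[of k] by (simp add: l_def field_simps power2_eq_square)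
  also have "\<dots> \<le> (a - a') + 2 / Llow * ((drift + \<beta> + 2 * model_curvature / c1) * (\<mu> k)\<^sup>2 + (drift + \<beta> + 2 * model_curvature / c1) * \<mu> k * d)"
  proof -
    have coeff: "0 \<le> drift + \<beta>" "0 \<le> 2 * model_curvature / c1" "0 \<le> \<mu> k * d" "0 \<le> \<mu> k"
      using drift_nonneg \<beta>_nonneg model_curvature_nonneg constants(3) d0 \<mu>_pos[of k] by auto
    have "(drift + \<beta>) * (\<mu> k)\<^sup>2 \<le> (drift + \<beta> + 2 * model_curvature / c1) * (\<mu> k)\<^sup>2"
      using coeff by (intro mult_right_mono) auto
    moreover have "2 * model_curvature / c1 * (\<mu> k * d) \<le> (drift + \<beta> + 2 * model_curvature / c1) * (\<mu> k * d)"
      using coeff by (intro mult_right_mono) auto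
    moreover have "0 \<le> (drift + \<beta>) * (\<mu> k)\<^sup>2" "0 \<le> 2 * model_curvature / c1 * (\<mu> k * d)"
      using coeff by (simp, metis coeff(2,3) mult_nonneg_nonneg)
    ultimately have "l * ((drift + \<beta>) * (\<mu> k)\<^sup>2 + 2 * model_curvature / c1 * (\<mu> k * d))
        \<le> 2 / Llow * ((drift + \<beta> + 2 * model_curvature / c1) * (\<mu> k)\<^sup>2 + (drift + \<beta> + 2 * model_curvature / c1) * (\<mu> k * d))"
      using l constants(1) by (intro mult_mono) auto
    then show ?thesis by (simp only: mult.assoc add_left_mono)
  qed
  finally have "l * \<mu> k * u (Suc k) \<le> (a - a') + 2 / Llow * ((drift + \<beta> + 2 * model_curvature / c1) * (\<mu> k)\<^sup>2 + (drift + \<beta> + 2 * model_curvature / c1) * \<mu> k * d)" .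
  moreover have "2 / Lmax * \<mu> k * u (Suc k) \<le> l * \<mu> k * u (Suc k)"
    using l u_nonneg[of "Suc k"] k \<mu>_pos[of k] by (intro mult_right_mono) auto
  ultimately show ?thesis unfolding a_def[symmetric] a'_def[symmetric] d_def[symmetric]
    by (simp add: algebra_simps)
qed

sublocale quasi_fejer minimizers x u \<mu> "2 / Lmax" "2 / Llow * (drift + \<beta> + 2 * model_curvature / c1)" b1 b2 r K
proof
  show "0 \<le> 2 / Llow * (drift + \<beta> + 2 * model_curvature / c1)"
    using constants drift_nonneg \<beta>_nonneg model_curvature_nonneg
    by (intro mult_nonneg_nonneg add_nonneg_nonneg) auto
  fix k assume "k \<ge> K"
  then show "u (Suc k) \<le> u k" using u_descent[of k] constants(3) \<mu>_pos[of k]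
    by (smt (verit) divide_nonneg_nonneg mult_nonneg_nonneg zero_le_power2)
qed (use minimizers_nonempty u_nonneg Lmax_pos distance_inequality \<mu>_pos \<mu>_decreasing \<mu>_lim \<mu>_div rate in auto)

text \<open>A step longer than \<open>c2 * \<mu> k * \<gamma>bar\<close> lowers \<open>u\<close> by a fixed multiple of \<open>\<mu> k\<close>, which a bounded
  decreasing sequence cannot afford forever when \<open>\<mu>\<close> is not summable.\<close>

lemma short_steps_recur: "\<exists>k\<ge>N. norm (x (Suc k) - x k) \<le> c2 * \<mu> k * \<gamma>bar"
proof (rule ccontr)
  assume "\<not> ?thesis"
  then have long: "c2 * \<mu> k * \<gamma>bar < norm (x (Suc k) - x k)" if "k \<ge> N" for k using that by (meson not_le)
  define M where "M = max N K"
  \<comment> \<open>The descent test gives \<open>c1 / (2 * \<mu> k)\<close> times the squared step, which exceeds \<open>e * \<mu> k\<close> after a long step.\<close>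
  define e where "e = c1 / 2 * (c2 * \<gamma>bar)\<^sup>2"
  have e: "e > 0" using constants \<gamma>bar_pos by (simp add: e_def)
  have drop: "e * \<mu> k \<le> u k - u (Suc k)" if "k \<ge> M" for k
  proof -
    have "(c2 * \<mu> k * \<gamma>bar)\<^sup>2 \<le> (norm (x (Suc k) - x k))\<^sup>2"
      using long[of k] that constants \<mu>_pos[of k] \<gamma>bar_pos by (intro power_mono) (auto simp: M_def)
    then have "c1 / (2 * \<mu> k) * (c2 * \<mu> k * \<gamma>bar)\<^sup>2 \<le> c1 / (2 * \<mu> k) * (norm (x (Suc k) - x k))\<^sup>2"
      using constants \<mu>_pos[of k] by (intro mult_left_mono) auto
    moreover have "c1 / (2 * \<mu> k) * (c2 * \<mu> k * \<gamma>bar)\<^sup>2 = e * \<mu> k"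
      using \<mu>_pos[of k] by (simp add: e_def power2_eq_square field_simps)
    ultimately show ?thesis using u_descent[of k] that by (simp add: M_def)
  qed
  have "(\<Sum>i<n. \<mu> (i + M)) \<le> u M / e" for n
  proof -
    have "e * (\<Sum>i<n. \<mu> (i + M)) + u (n + M) \<le> u M"
    proof (induction n)
      case (Suc n)
      then show ?case using drop[of "n + M"] by (simp add: algebra_simps)
    qed simp
    moreover have "0 \<le> u (n + M)" using u_nonneg[of "n + M"] by (simp add: M_def)
    ultimately show ?thesis using e by (simp add: field_simps)
  qed
  then have "summable (\<lambda>i. \<mu> (i + M))"
    using \<mu>_pos by (intro summableI_nonneg_bounded) (auto simp: less_imp_le)
  then show False using \<mu>_div by (simp add: summable_iff_shift)
qed

text \<open>A short step that does not increment \<open>t\<close> must end where the smoothed constraint is at most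
  \<open>2 \<alpha>\<^sub>3 \<mu>\<close>, so every limit point of the ends of short steps is feasible. It also minimizes the
  penalty function since \<open>u \<rightarrow> 0\<close>.\<close>

lemma converges_to_feasible_minimizer:
  obtains z where "z \<in> minimizers" "h (c z) \<le> 0" "x \<longlonglongrightarrow> z"
proof -
  let ?short = "{k. k \<ge> K \<and> norm (x (Suc k) - x k) \<le> c2 * \<mu> k * \<gamma>bar}"
  have "infinite ?short"
    unfolding infinite_nat_iff_unbounded_le
  proof
    fix N
    show "\<exists>n\<ge>N. n \<in> ?short"
      using short_steps_recur[of "max N K"] by auto
  qed
  then obtain p :: "nat \<Rightarrow> nat" where p: "strict_mono p" "\<And>n. p n \<ge> K"
      "\<And>n. norm (x (Suc (p n)) - x (p n)) \<le> c2 * \<mu> (p n) * \<gamma>bar"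
    using infinite_enumerate[of ?short] by auto
  obtain z s where z: "z \<in> C" and s: "strict_mono s" "((\<lambda>n. x (Suc (p n))) \<circ> s) \<longlonglongrightarrow> z"
    using C(1) x_in_C unfolding compact_eq_seq_compact_metric by (metis seq_compactE)
  define q where "q n = Suc (p (s n))" for n
  have q: "strict_mono q" using p(1) s(1) by (simp add: q_def strict_mono_def)
  have xq: "(x \<circ> q) \<longlonglongrightarrow> z" using s(2) by (simp add: o_def q_def)
  have small: "h (c (x (q n))) \<le> (2 * (\<alpha>31\<phi> + \<alpha>32\<phi>) + \<alpha>31h) * \<mu> (p (s n))" for n
  proof -
    have "h\<^sub>\<mu> (\<mu> (p (s n))) (c (x (q n))) \<le> 2 * (\<alpha>31\<phi> + \<alpha>32\<phi>) * \<mu> (p (s n))"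
      using frozen[OF p(2), of "s n"] p(3)[of "s n"] increment_iff[of "p (s n)"] by (simp add: q_def not_less)
    then show ?thesis using h\<^sub>\<mu>_smooth(4)[OF \<mu>_pos, of "c (x (q n))" "p (s n)"] by (simp add: algebra_simps)
  qed
  have ps: "strict_mono (p \<circ> s)" using p(1) s(1) by (rule strict_mono_o)
  have "(\<lambda>n. (2 * (\<alpha>31\<phi> + \<alpha>32\<phi>) + \<alpha>31h) * \<mu> (p (s n))) \<longlonglongrightarrow> (2 * (\<alpha>31\<phi> + \<alpha>32\<phi>) + \<alpha>31h) * 0"
    using LIMSEQ_subseq_LIMSEQ[OF \<mu>_lim ps] by (intro tendsto_intros) (simp add: o_def)
  moreover have hcq: "(\<lambda>n. h (c (x (q n)))) \<longlonglongrightarrow> h (c z)"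
    using continuous_on_tendsto_compose[OF continuous_hc[of UNIV] xq] by (simp add: o_def)
  ultimately have feas: "h (c z) \<le> 0"
    using LIMSEQ_le[OF hcq] small by auto
  have "(\<lambda>n. penalty (x (q n))) \<longlonglongrightarrow> penalty z"
    using continuous_on_tendsto_compose[OF continuous_penalty[of UNIV] xq] by (simp add: o_def)
  moreover have "(\<lambda>n. u (q n) + penalty_min) \<longlonglongrightarrow> 0 + penalty_min"
    using LIMSEQ_subseq_LIMSEQ[OF u_tendsto_0 q] by (intro tendsto_intros) (simp add: o_def)
  moreover have "penalty (x (q n)) \<le> u (q n) + penalty_min" for n
    using penalty_gap_le_u[of "q n"] p(2)[of "s n"] by (simp add: q_def)
  ultimately have "penalty z \<le> 0 + penalty_min" by (intro LIMSEQ_le) auto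
  then have "z \<in> minimizers" using z penalty_min_le by (force simp: minimizers_def)
  then show ?thesis using that feas convergence_from_cluster_point[OF _ q xq] by blast
qed


text \<open>The limit \<open>z\<close> is feasible and minimizes \<open>penalty\<close> on \<open>C\<close>; on feasible points \<open>penalty\<close> is
  \<open>\<gamma>bar\<close> times the objective. Hence \<open>z\<close> is a solution, the minimum of \<open>penalty\<close> is \<open>\<gamma>bar\<close> times the optimal
  value, and each solution minimizes \<open>penalty\<close>. In particular the base of the power in the error bound is
  nonnegative; it is at most \<open>u k / \<gamma>bar\<close>.\<close>

lemma convergence_rate_to_solution:
  fixes \<kappa> \<theta> \<epsilon>0 \<epsilon>1 :: real
  defines "\<psi> \<equiv> psi f P1 (\<lambda>_. 0) C" and "\<Omega> \<equiv> solution_set (psi f P1 (\<lambda>_. 0) C) (\<lambda>z. h (c z)) C"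
  assumes eb: "error_bound \<psi> (\<lambda>z. h (c z)) C \<gamma>bar \<kappa> \<theta> \<epsilon>0 \<epsilon>1"
    and pos: "\<kappa> > 0" "\<epsilon>0 > 0" "\<epsilon>1 > 0"
    and p: "p > 1" "1 / p \<le> 2 * (1 - \<theta>)"
    and s: "0 < 2 * s" "2 * s \<le> 2 * r - 1" "2 * s * (p - 1) \<le> 1 - r"
  shows "\<exists>z\<in>\<Omega>. x \<longlonglongrightarrow> z \<and> (\<exists>A>0. \<exists>k'. \<forall>k\<ge>k'. norm (x k - z) \<le> A * (1 + real k) powr (- s))"
proof -
  obtain z where z: "z \<in> minimizers" "h (c z) \<le> 0" "x \<longlonglongrightarrow> z" by (rule converges_to_feasible_minimizer)
  have zC: "z \<in> C" using z by (simp add: minimizers_def)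
  define v where "v = f z + P1 z"
  have mv: "penalty_min = \<gamma>bar * v" using penalty_minimal[OF z(1)] z(2) by (simp add: penalty_def v_def pos_part_def)
  have \<psi>C: "\<psi> w = ereal (f w + P1 w)" if "w \<in> C" for w
    using that by (simp add: \<psi>_def psi_def indicator_ext_def)
  have v_le: "v \<le> f w + P1 w" if "w \<in> C" "h (c w) \<le> 0" for w
  proof -
    have "\<gamma>bar * v \<le> \<gamma>bar * (f w + P1 w)" using penalty_min_le[OF that(1)] that(2) mv by (simp add: penalty_def pos_part_def)
    then show ?thesis using \<gamma>bar_pos by simp
  qed
  have opt: "opt_value \<psi> (\<lambda>z. h (c z)) C = ereal v"
    unfolding opt_value_def
  proof (rule antisym)
    show "(INF w\<in>feasible_set (\<lambda>z. h (c z)) C. \<psi> w) \<le> ereal v"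
      using zC z(2) by (intro INF_lower2[of z]) (auto simp: feasible_set_def \<psi>C v_def)
    show "ereal v \<le> (INF w\<in>feasible_set (\<lambda>z. h (c z)) C. \<psi> w)"
      using v_le by (intro INF_greatest) (auto simp: feasible_set_def \<psi>C)
  qed
  have \<Omega>: "\<Omega> = {w \<in> C. h (c w) \<le> 0 \<and> f w + P1 w = v}"
    using opt unfolding \<Omega>_def \<psi>_def[symmetric] solution_set_def by (auto simp: feasible_set_def \<psi>C)
  have z\<Omega>: "z \<in> \<Omega>" using zC z(2) by (simp add: \<Omega> v_def)
  have \<Omega>S: "\<Omega> \<subseteq> minimizers" using penalty_min_le mv by (auto simp: \<Omega> minimizers_def penalty_def pos_part_def)
  have "closed ({w \<in> C. h (c w) \<le> 0} \<inter> {w \<in> C. f w + P1 w = v})"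
    using compact_imp_closed[OF C(1)]
    by (intro closed_Int continuous_on_closed_Collect_le continuous_closed_preimage_constant
        continuous_hc continuous_intros continuous_f continuous_P1)
  then have \<Omega>_closed: "closed \<Omega>" unfolding \<Omega> by (simp add: Collect_conj_eq Int_assoc Int_left_commute)
  obtain N where N: "\<And>k. k \<ge> N \<Longrightarrow> dist (x k) z < \<epsilon>0"
    using z(3) pos(2) unfolding lim_sequentially by blast
  have "0 < min 1 (\<gamma>bar * \<epsilon>1)" using \<gamma>bar_pos pos by simp
  then obtain N1 where N1: "\<And>k. k \<ge> N1 \<Longrightarrow> u k < min 1 (\<gamma>bar * \<epsilon>1)"
    using order_tendstoD(2)[OF u_tendsto_0] unfolding eventually_sequentially by blast
  define H where "H = \<kappa>\<^sup>2 * (1 / \<gamma>bar) powr (2 * (1 - \<theta>))"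
  have p0: "0 < 1 / p" "0 \<le> 2 * (1 - \<theta>)" using p by (simp, smt (verit) divide_nonneg_nonneg)
  have "(infdist (x k) \<Omega>)\<^sup>2 \<le> H * u k powr (1 / p)" if k: "k \<ge> max K (max N N1)" for k
  proof -
    define y where "y = (penalty (x k) - penalty_min) / \<gamma>bar"
    have uk: "0 \<le> u k" "u k < 1" "u k < \<gamma>bar * \<epsilon>1" using u_nonneg[of k] N1[of k] k by auto
    have y: "0 \<le> y" "y \<le> 1 / \<gamma>bar * u k" "y \<le> \<epsilon>1"
      using penalty_gap_le_u[of k] k penalty_min_le[OF x_in_C[of k]] \<gamma>bar_pos uk(3)
      by (auto simp: y_def pos_divide_le_eq mult.commute intro: divide_right_mono)
    have Fy: "\<psi> (x k) + ereal (inverse \<gamma>bar * pos_part (h (c (x k)))) = ereal (v + y)"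
      using \<gamma>bar_pos by (simp add: \<psi>C[OF x_in_C] y_def penalty_def mv field_simps)
    have "infdist (x k) \<Omega> \<le> \<epsilon>0" using infdist_le[OF z\<Omega>, of "x k"] N[of k] k by simp
    then have "infdist (x k) \<Omega> \<le> \<kappa> * real_of_ereal (ereal (v + y) - ereal v) powr (1 - \<theta>)"
      using eb[unfolded error_bound_def, rule_format, of "x k"] y(3)
      unfolding Fy opt \<Omega>_def \<psi>_def[symmetric] by simp
    also have "\<dots> = \<kappa> * y powr (1 - \<theta>)" by simp
    finally have "(infdist (x k) \<Omega>)\<^sup>2 \<le> (\<kappa> * y powr (1 - \<theta>))\<^sup>2"
      by (intro power_mono infdist_nonneg)
    also have "\<dots> = \<kappa>\<^sup>2 * y powr (2 * (1 - \<theta>))"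
      by (simp add: power_mult_distrib power2_eq_square powr_add[symmetric])
    also have "\<dots> \<le> \<kappa>\<^sup>2 * (1 / \<gamma>bar * u k) powr (2 * (1 - \<theta>))"
      using y p0(2) by (intro mult_left_mono powr_mono2) auto
    also have "\<dots> = H * u k powr (2 * (1 - \<theta>))"
      using \<gamma>bar_pos uk by (simp only: powr_mult H_def)
    also have "\<dots> \<le> H * u k powr (1 / p)"
      using uk p(2) p0 by (intro mult_left_mono powr_mono') (auto simp: H_def)
    finally show ?thesis .
  qed
  then have "\<exists>A>0. \<exists>k'. \<forall>k\<ge>k'. norm (x k - z) \<le> A * (1 + real k) powr (- s)"
    using rate_from_error_bound[OF z(3) \<Omega>S \<Omega>_closed _ _ _ p(1) s, of H "max K (max N N1)"] z\<Omega>
    by (auto simp: H_def)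
  then show ?thesis using z(3) z\<Omega> by blast
qed

end

context sESQM_run
begin

text \<open>The least index from which \<open>t\<close> is constant exists, so \<open>k_bar t + 1\<close> is that index.\<close>

lemma gamma_bar_frozen:
  assumes "\<exists>K. \<forall>j\<ge>K. t j = t K"
  shows "\<exists>K. \<forall>k\<ge>K. \<gamma> k = gamma_bar t \<gamma> \<and> t (Suc k) \<noteq> t k + 1"
proof -
  define K where "K = (LEAST k. \<forall>j\<ge>k. t j = t k)"
  have K: "\<forall>j\<ge>K. t j = t K" unfolding K_def using assms by (rule LeastI_ex)
  have "gamma_bar t \<gamma> = \<gamma> K" by (simp add: gamma_bar_def k_bar_def K_def)
  then have "\<gamma> k = gamma_bar t \<gamma> \<and> t (Suc k) \<noteq> t k + 1" if "k \<ge> K" for k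
    using K[rule_format, of k] K[rule_format, of "Suc k"] that by (simp add: \<gamma>_eq)
  then show ?thesis by blast
qed

end

text \<open>The choice of \<open>p\<close>, with \<open>\<sigma> = 2 * s\<close> in the recursion. Any \<open>p\<close> with \<open>1 / p \<le> 2 * (1 - \<theta>)\<close> is admissible
  since \<open>u\<close> is eventually below \<open>1\<close>. For \<open>\<theta> \<le> 1/2\<close>, \<open>p = r / (2 * r - 1)\<close> satisfies
  \<open>(2 * r - 1) * (p - 1) = 1 - r\<close>.\<close>

lemma rate_exponents:
  fixes r \<theta> :: real
  assumes r: "1/2 < r" "r < 1" and \<theta>: "\<theta> < 1"
  defines "s \<equiv> if \<theta> \<le> 1/2 then r - 1/2 else min (r - 1/2) ((1 - r) * (1 - \<theta>) / (2 * \<theta> - 1))"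
  shows "\<exists>p>1. 1 / p \<le> 2 * (1 - \<theta>) \<and> 0 < 2 * s \<and> 2 * s \<le> 2 * r - 1 \<and> 2 * s * (p - 1) \<le> 1 - r"
proof (cases "\<theta> \<le> 1/2")
  case True
  define p where "p = r / (2 * r - 1)"
  have p: "p > 1" "1 / p = (2 * r - 1) / r" "(2 * r - 1) * (p - 1) = 1 - r"
    using r by (auto simp: p_def field_simps)
  have "1 / p \<le> 1" using p(1) by simp
  also have "\<dots> \<le> 2 * (1 - \<theta>)" using True by simp
  finally show ?thesis using True r p(1,3) by (intro exI[of _ p]) (auto simp: s_def algebra_simps)
next
  case False
  define q where "q = (1 - r) * (1 - \<theta>) / (2 * \<theta> - 1)"
  have q: "q > 0" "q * (2 * \<theta> - 1) = (1 - r) * (1 - \<theta>)" using False r \<theta> by (auto simp: q_def)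
  have s: "s = min (r - 1/2) q" using False by (simp add: s_def q_def)
  define p where "p = 1 / (2 * (1 - \<theta>))"
  have p: "p > 1" "1 / p = 2 * (1 - \<theta>)" using False \<theta> by (auto simp: p_def field_simps)
  have "2 * s * (p - 1) \<le> 2 * q * (p - 1)" using p by (intro mult_right_mono) (auto simp: s)
  also have "\<dots> = q * (2 * \<theta> - 1) / (1 - \<theta>)" using \<theta> by (simp add: p_def field_simps)
  also have "\<dots> = 1 - r" using \<theta> unfolding q(2) by simp
  finally have "2 * s * (p - 1) \<le> 1 - r" .
  moreover have "0 < s" "s \<le> r - 1/2" using q(1) r by (auto simp: s)
  ultimately show ?thesis using p by (intro exI[of _ p]) auto
qed

theorem theorem4p2:
  fixes C :: "'a::euclidean_space set"
    and f P1 P2 :: "'a \<Rightarrow> real"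
    and c :: "'a \<Rightarrow> 'b::euclidean_space"
    and h :: "'b \<Rightarrow> real"
    and h\<^sub>\<mu> :: "real \<Rightarrow> 'b \<Rightarrow> real"
    and \<Phi> :: "real \<Rightarrow> real \<Rightarrow> real"
    and L\<^sub>f L\<^sub>c M\<^sub>c M\<^sub>h :: real
    and \<alpha>1h \<alpha>2h \<alpha>31h \<alpha>32h \<alpha>4h \<alpha>1\<phi> \<alpha>2\<phi> \<alpha>31\<phi> \<alpha>32\<phi> \<alpha>4\<phi> :: real
    and Llow Lup c1 c2 :: real
    and x \<xi> :: "nat \<Rightarrow> 'a"
    and L0 L \<mu> \<gamma> \<gamma>hat :: "nat \<Rightarrow> real"
    and t :: "nat \<Rightarrow> nat"
    and M\<gamma> r b1 b2 \<kappa> \<theta> \<epsilon>0 \<epsilon>1 :: real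
    and k1 :: nat
  assumes C: "compact C" "convex C" "feasible_set (\<lambda>z. h (c z)) C \<noteq> {}"
    and f: "C1_fun f" "L\<^sub>f > 0" "smooth_on_set L\<^sub>f C f"
    and c: "C1_fun c" "L\<^sub>c \<ge> 0" "smooth_on_set L\<^sub>c C c" "M\<^sub>c > 0" "M\<^sub>c-lipschitz_on C c"
    and P: "convex_on UNIV P1" "convex_on UNIV P2"
    and h: "convex_on UNIV h" "M\<^sub>h > 0" "M\<^sub>h-lipschitz_on UNIV h"
    and SA_h: "smoothing_approx h h\<^sub>\<mu> \<alpha>1h \<alpha>2h \<alpha>31h \<alpha>32h" "parameter_controlled h\<^sub>\<mu> \<alpha>4h"
    and SA_\<phi>: "smoothing_approx pos_part \<Phi> \<alpha>1\<phi> \<alpha>2\<phi> \<alpha>31\<phi> \<alpha>32\<phi>" "parameter_controlled \<Phi> \<alpha>4\<phi>"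
    and alg: "sESQM f P1 P2 C c h\<^sub>\<mu> \<Phi> (\<alpha>31\<phi> + \<alpha>32\<phi>) Llow Lup c1 c2 \<gamma>hat x \<xi> L0 L \<mu> t \<gamma>"
    and CQ: "\<forall>z\<in>C. h (c z) \<ge> 0 \<longrightarrow>
               0 \<notin> limiting_subdiff (\<lambda>y. ereal (h (c y))) z + normal_cone C z"
    and mu: "\<forall>k. \<mu> k > 0" "decseq \<mu>" "\<mu> \<longlonglongrightarrow> 0"
            "filterlim (\<lambda>K. \<Sum>k = nat \<lceil>real K / 2\<rceil>..K. \<mu> k) at_top sequentially"
    and gamma: "\<gamma>hat \<longlonglongrightarrow> 0" "M\<gamma> > 1"
               "\<forall>k. 0 < \<gamma>hat (Suc k) \<and> \<gamma>hat (Suc k) < \<gamma>hat k \<and> \<gamma>hat k \<le> M\<gamma> * \<gamma>hat (Suc k)"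
    and conv: "convex_on UNIV f" "P2 = (\<lambda>_. 0)" "cone_convex (uminus ` hzn h) c"
    and rate: "1/2 < r" "r < 1" "b1 > 0" "b2 > 0"
              "\<forall>k\<ge>k1. b1 * (1 + real k) powr (- r) \<le> \<mu> k \<and> \<mu> k \<le> b2 * (1 + real k) powr (- r)"
    and eb: "\<kappa> > 0" "0 \<le> \<theta>" "\<theta> < 1" "\<epsilon>0 > 0" "0 < \<epsilon>1" "\<epsilon>1 < 1"
            "error_bound (psi f P1 P2 C) (\<lambda>z. h (c z)) C (gamma_bar t \<gamma>) \<kappa> \<theta> \<epsilon>0 \<epsilon>1"
  shows "\<exists>xbar \<in> solution_set (psi f P1 P2 C) (\<lambda>z. h (c z)) C.
           x \<longlonglongrightarrow> xbar \<and>
           (\<exists>\<kappa>' > 0. \<exists>k'. \<forall>k\<ge>k'.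
              norm (x k - xbar) \<le> \<kappa>' * (1 + real k) powr
                (- (if \<theta> \<le> 1/2 then r - 1/2
                    else min (r - 1/2) ((1 - r) * (1 - \<theta>) / (2 * \<theta> - 1)))))"
proof -
  obtain p where p: "p > 1" "1 / p \<le> 2 * (1 - \<theta>)"
    "0 < 2 * (if \<theta> \<le> 1/2 then r - 1/2 else min (r - 1/2) ((1 - r) * (1 - \<theta>) / (2 * \<theta> - 1)))"
    "2 * (if \<theta> \<le> 1/2 then r - 1/2 else min (r - 1/2) ((1 - r) * (1 - \<theta>) / (2 * \<theta> - 1))) \<le> 2 * r - 1"
    "2 * (if \<theta> \<le> 1/2 then r - 1/2 else min (r - 1/2) ((1 - r) * (1 - \<theta>) / (2 * \<theta> - 1))) * (p - 1) \<le> 1 - r"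
    using rate_exponents[OF rate(1,2) eb(3)] by blast
  have P2: "P2 = (\<lambda>_. 0)" by (rule conv(2))
  interpret sESQM_run C c h h\<^sub>\<mu> \<Phi> L\<^sub>c M\<^sub>c M\<^sub>h \<alpha>1h \<alpha>2h \<alpha>31h \<alpha>32h \<alpha>4h \<alpha>1\<phi> \<alpha>2\<phi> \<alpha>31\<phi> \<alpha>32\<phi> \<alpha>4\<phi>
    f P1 L\<^sub>f Llow Lup c1 c2 x \<xi> L0 L \<mu> \<gamma> \<gamma>hat t
    using C(1,2) c h SA_h SA_\<phi> f conv(1,3) P(1) alg[unfolded P2] by unfold_locales
  obtain K0 where K0: "\<forall>k\<ge>K0. \<gamma> k = gamma_bar t \<gamma> \<and> t (Suc k) \<noteq> t k + 1"
    using gamma_bar_frozen penalty_parameter_freezes[OF CQ mu(3) gamma(1)] by blast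
  have "\<not> summable \<mu>"
    using mu(1) by (intro not_summable_if_tail_sums_unbounded mu(4)) (auto simp: less_imp_le)
  then interpret frozen_sESQM_run C c h h\<^sub>\<mu> \<Phi> L\<^sub>c M\<^sub>c M\<^sub>h \<alpha>1h \<alpha>2h \<alpha>31h \<alpha>32h \<alpha>4h \<alpha>1\<phi> \<alpha>2\<phi> \<alpha>31\<phi> \<alpha>32\<phi> \<alpha>4\<phi>
    f P1 L\<^sub>f Llow Lup c1 c2 x \<xi> L0 L \<mu> \<gamma> \<gamma>hat t "gamma_bar t \<gamma>" b1 b2 r "max K0 k1"
    using K0 mu(3) rate by unfold_locales auto
  from convergence_rate_to_solution[OF eb(7)[unfolded P2] eb(1,4,5) p] show ?thesis
    unfolding P2 .
qed

end
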